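(* Let $(\nu,x_0)\in\Omega$, and let $u_0=\nu^2-\nu$, $u_{n+1}=u_n^2-\nu$ for $n\ge0$. Write $K_n=K^{\nu,x_0}_n$, $K=K^{\nu,x_0}$. (1) If $u_0-x_0$ is not a square of an integer, then the only proper subfields of $K$ are the fields $K_n$, $n\ge0$. (2) If $u_0-x_0=a^2$ for an integer $a$ and $\nu\ge3$, then the only proper subfields of $K$ are the fields $K_n$ ($n\ge0$) together with the two quadratic fields $\mathbb{Q}(\sqrt{2(\nu-a)})$ and $\mathbb{Q}(\sqrt{2(\nu+a)})$, which are contained in $K_2$. Moreover, there are infinitely many pairs $(\nu,x_0)\in\Omega$ for which this case occurs. (3) The only proper subfield of $K^{2,1}$ of infinite degree over $\mathbb{Q}$ is $K^{2,0}$. We have $K^{2,1}=K^{2,0}(\sqrt3)$, and for each $n\ge1$, $K^{2,1}_{n+1}=K^{2,0}_n(\sqrt3)$ with $K^{2,0}_n\neq K^{2,1}_{n+1}$. Moreover, setting $M_n=\mathbb{Q}(\sqrt3\,x^{2,0}_n)$, the subfields of $K^{2,1}$ are exactly: $\mathbb{Q}$, $K^{2,0}$, $K^{2,1}$, and for each $n\ge1$ the three pairwise distinct fields $K^{2,0}_n$, $K^{2,1}_n$, $M_n$, which are the only subfields of $K^{2,1}$ of degree $2^n$ over $\mathbb{Q}$; the inclusions of degree $2$ among these are $\mathbb{Q}\subset K^{2,0}_1,\ \mathbb{Q}\subset K^{2,1}_1,\ \mathbb{Q}\subset M_1$, and for every $n\ge1$: $K^{2,0}_n\subset K^{2,0}_{n+1}$,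 $K^{2,0}_n\subset M_{n+1}$, $K^{2,0}_n\subset K^{2,1}_{n+1}$, $M_n\subset K^{2,1}_{n+1}$, $K^{2,1}_n\subset K^{2,1}_{n+1}$, together with $K^{2,0}\subset K^{2,1}$ (and $M_{n+1}\not\supseteq M_n$).
   Context: For integers $\nu\ge2$ and $x_0\ge0$, define $x^{\nu,x_0}_{n+1}=\pm\sqrt{\nu+x^{\nu,x_0}_n}$ for $n\ge0$ (any choice of sign at each step), $K^{\nu,x_0}_n=\mathbb{Q}(x^{\nu,x_0}_n)$ and $K^{\nu,x_0}=\bigcup_{n\ge0}K^{\nu,x_0}_n$. $\Omega$ is the set of pairs $(\nu,x_0)$ such that $[K^{\nu,x_0}_{n+1}:K^{\nu,x_0}_n]=2$ for every $n\ge0$ and $K^{\nu,x_0}$ is totally real. The pairs $(2,0)$ and $(2,1)$ lie in $\Omega$. *)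

theory Defs
  imports Complex_Main "HOL-Algebra.Generated_Fields" "HOL-Algebra.Embedded_Algebras"
    "HOL-Algebra.Algebraic_Closure_Type"
begin

text \<open>All fields are subfields of the complex numbers, the latter regarded as a ring record.\<close>

abbreviation CC :: "complex ring"
  where "CC \<equiv> ring_of_type_algebra"

definition adjoin :: "complex set \<Rightarrow> complex set \<Rightarrow> complex set"
  where "adjoin F S = generate_field CC (F \<union> S)"

definition subfields_of :: "complex set \<Rightarrow> complex set set"
  where "subfields_of K = {F. subfield F CC \<and> F \<subseteq> K}"

definition proper_subfields_of :: "complex set \<Rightarrow> complex set set"
  where "proper_subfields_of K = {F. subfield F CC \<and> F \<subset> K}"

definition has_degree :: "complex set \<Rightarrow> complex set \<Rightarrow> nat \<Rightarrow> bool"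
  where "has_degree E F d \<longleftrightarrow> F \<subseteq> E \<and> ring.dimension CC d F E"

definition infinite_degree :: "complex set \<Rightarrow> complex set \<Rightarrow> bool"
  where "infinite_degree E F \<longleftrightarrow> F \<subseteq> E \<and> (\<nexists>d. has_degree E F d)"

definition totally_real :: "complex set \<Rightarrow> bool"
  where "totally_real K \<longleftrightarrow> (\<forall>\<sigma>\<in>ring_hom (CC\<lparr>carrier := K\<rparr>) CC. \<sigma> ` K \<subseteq> \<real>)"

text \<open>The sequence \<open>s\<close> records the choice of sign at each step.\<close>

primrec xseq :: "int \<Rightarrow> int \<Rightarrow> (nat \<Rightarrow> bool) \<Rightarrow> nat \<Rightarrow> complex"
  where
    "xseq \<nu> x0 s 0 = of_int x0"
  | "xseq \<nu> x0 s (Suc n) =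
       (if s n then csqrt (of_int \<nu> + xseq \<nu> x0 s n) else - csqrt (of_int \<nu> + xseq \<nu> x0 s n))"

definition Kn :: "int \<Rightarrow> int \<Rightarrow> (nat \<Rightarrow> bool) \<Rightarrow> nat \<Rightarrow> complex set"
  where "Kn \<nu> x0 s n = adjoin \<rat> {xseq \<nu> x0 s n}"

definition Kinf :: "int \<Rightarrow> int \<Rightarrow> (nat \<Rightarrow> bool) \<Rightarrow> complex set"
  where "Kinf \<nu> x0 s = (\<Union>n. Kn \<nu> x0 s n)"

text \<open>When every step has degree 2, different sign choices give conjugate generators, so the
  conditions below hold for all sign choices as soon as they hold for one.\<close>

definition Omega :: "(int \<times> int) set"
  where "Omega = {(\<nu>, x0). \<nu> \<ge> 2 \<and> x0 \<ge> 0 \<and>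
    (\<forall>s. (\<forall>n. has_degree (Kn \<nu> x0 s (Suc n)) (Kn \<nu> x0 s n) 2) \<and> totally_real (Kinf \<nu> x0 s))}"

primrec u :: "int \<Rightarrow> nat \<Rightarrow> int"
  where
    "u \<nu> 0 = \<nu>\<^sup>2 - \<nu>"
  | "u \<nu> (Suc n) = (u \<nu> n)\<^sup>2 - \<nu>"

definition sqrtC :: "int \<Rightarrow> complex"
  where "sqrtC d = csqrt (of_int d)"

definition Mn :: "(nat \<Rightarrow> bool) \<Rightarrow> nat \<Rightarrow> complex set"
  where "Mn s n = adjoin \<rat> {sqrtC 3 * xseq 2 0 s n}"

end

theory Submission
  imports Defs "HOL-Library.Periodic_Fun"
begin

text \<open>
  A proper subfield of an iterated quadratic extension \<open>T\<close> of the rationals lies in a subfield of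
  index two, and such a subfield is the fixed field of an involution \<open>\<tau>\<close> of \<open>T\<close>; so it suffices to
  know the involutions of the fields \<open>K\<^sub>n\<close>. Let \<open>x\<^sub>k\<close> be the first generator moved by \<open>\<tau>\<close>, so that
  \<open>\<tau> x\<^sub>k = - x\<^sub>k\<close>. If \<open>k < n\<close>, then \<open>x\<^sub>k\<^sub>+\<^sub>1 \<tau> x\<^sub>k\<^sub>+\<^sub>1\<close> is fixed by \<open>\<tau>\<close> and is a square root of
  \<open>u\<^sub>0 - x\<^sub>k\<^sub>-\<^sub>1\<close>. Norms down the tower turn such a root into an integral square root of \<open>u\<^sub>j - x\<^sub>0\<close>
  for some \<open>j \<ge> k - 1\<close>, and this is excluded for \<open>j \<ge> 1\<close> because \<open>u\<^sub>j\<close> lies just below the square of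
  \<open>u\<^sub>j\<^sub>-\<^sub>1\<close>. What remains is \<open>k = n\<close>, with fixed field \<open>K\<^sub>n\<^sub>-\<^sub>1\<close>, and, if \<open>u\<^sub>0 - x\<^sub>0 = a\<^sup>2\<close>, the
  case \<open>k = 1\<close>. There another norm shows \<open>n = 2\<close>, and \<open>K\<^sub>2\<close> is biquadratic over the rationals,
  generated by \<open>x\<^sub>2 \<plusminus> a / x\<^sub>2\<close>, the square roots of \<open>2 (\<nu> \<plusminus> a)\<close>, whose product is \<open>2 x\<^sub>1\<close>.

  For \<open>\<nu> = 2\<close> the map \<open>t \<mapsto> t\<^sup>3 - 3 t\<close> takes the tower \<open>K\<close> over \<open>1\<close> to a tower over \<open>0\<close>, which gives
  \<open>K\<^sub>n\<^sub>+\<^sub>1 = L\<^sub>n(\<surd>3)\<close> for the tower \<open>L\<close> over \<open>0\<close>. Every involution of \<open>L\<^sub>n\<^sub>+\<^sub>1(\<surd>3)\<close> fixes \<open>L\<^sub>n\<close>, so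
  the subfields of index two are those of a biquadratic extension of \<open>L\<^sub>n\<close>.
\<close>

section \<open>Subfields of the complex numbers\<close>

lemma CC_simps [simp]:
  "carrier CC = UNIV" "\<one>\<^bsub>CC\<^esub> = 1" "\<zero>\<^bsub>CC\<^esub> = 0" "a \<otimes>\<^bsub>CC\<^esub> b = a * b" "a \<oplus>\<^bsub>CC\<^esub> b = a + b"
  by (auto simp: ring_of_type_algebra_def)

interpretation CC: cring CC by rule

lemma field_CC: "field CC" by rule

lemma CC_a_inv [simp]: "\<ominus>\<^bsub>CC\<^esub> a = - a"
  by (rule CC.minus_equality) auto

lemma CC_m_inv [simp]: "a \<noteq> 0 \<Longrightarrow> inv\<^bsub>CC\<^esub> a = inverse a"
  by (rule CC.comm_inv_char) auto

lemma subfield_CC_I: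
  assumes "1 \<in> F" "\<And>a b. a \<in> F \<Longrightarrow> b \<in> F \<Longrightarrow> a + b \<in> F" "\<And>a. a \<in> F \<Longrightarrow> - a \<in> F"
    "\<And>a b. a \<in> F \<Longrightarrow> b \<in> F \<Longrightarrow> a * b \<in> F" "\<And>a. a \<in> F \<Longrightarrow> a \<noteq> 0 \<Longrightarrow> inverse a \<in> F"
  shows "subfield F CC"
proof (rule field.subfieldI'[OF field_CC])
  show "subring F CC" by (rule CC.subringI) (use assms in auto)
  show "inv\<^bsub>CC\<^esub> k \<in> F" if "k \<in> F - {\<zero>\<^bsub>CC\<^esub>}" for k using that assms(5) by auto
qed

context
  fixes F :: "complex set"
  assumes subfield: "subfield F CC"
begin

lemma subfield_one: "1 \<in> F" and subfield_zero: "0 \<in> F"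
  and subfield_uminus: "a \<in> F \<Longrightarrow> - a \<in> F"
  and subfield_add: "a \<in> F \<Longrightarrow> b \<in> F \<Longrightarrow> a + b \<in> F"
  and subfield_mult: "a \<in> F \<Longrightarrow> b \<in> F \<Longrightarrow> a * b \<in> F"
  using subringE[OF subfieldE(1)[OF subfield]] by auto

lemma subfield_diff: "a \<in> F \<Longrightarrow> b \<in> F \<Longrightarrow> a - b \<in> F"
  using subfield_add[of a "- b"] subfield_uminus[of b] by simp

lemma subfield_inverse: "a \<in> F \<Longrightarrow> inverse a \<in> F"
  using CC.subfield_m_inv(1)[OF subfield, of a] subfield_zero by (cases "a = 0") auto

lemma subfield_divide: "a \<in> F \<Longrightarrow> b \<in> F \<Longrightarrow> a / b \<in> F"
  by (simp add: divide_inverse subfield_mult subfield_inverse)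

lemma subfield_power: "a \<in> F \<Longrightarrow> a ^ n \<in> F"
  by (induction n) (auto simp: subfield_one subfield_mult)

lemma subfield_of_nat: "of_nat n \<in> F"
  by (induction n) (auto simp: subfield_zero subfield_one subfield_add)

lemma subfield_of_int: "of_int k \<in> F"
  by (cases k) (auto simp: subfield_of_nat subfield_uminus subfield_diff subfield_one)

lemma subfield_numeral: "numeral k \<in> F"
  using subfield_of_nat[of "numeral k"] by simp

lemma Rats_subset_subfield: "\<rat> \<subseteq> F"
  by (metis Rats_cases' subfield_divide subfield_of_int subsetI)

end

lemmas subfield_closed = subfield_one subfield_zero subfield_uminus subfield_add subfield_mult
  subfield_diff subfield_inverse subfield_divide subfield_power subfield_of_int subfield_numeral

lemma subfield_Rats: "subfield \<rat> CC"
  by (rule subfield_CC_I) auto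

lemma subfield_Int: "subfield F CC \<Longrightarrow> subfield G CC \<Longrightarrow> subfield (F \<inter> G) CC"
  by (rule subfield_CC_I) (auto simp: subfield_closed)

lemma subfield_chain_Union:
  fixes K :: "nat \<Rightarrow> complex set"
  assumes mono: "\<And>m n. m \<le> n \<Longrightarrow> K m \<subseteq> K n" and K: "\<And>n. subfield (K n) CC"
  shows "subfield (\<Union>n. K n) CC"
proof (rule subfield_CC_I)
  fix a b assume "a \<in> (\<Union>n. K n)" "b \<in> (\<Union>n. K n)"
  then obtain m n where "a \<in> K m" "b \<in> K n" by blast
  hence "a \<in> K (max m n)" "b \<in> K (max m n)"
    using mono[of m "max m n"] mono[of n "max m n"] by auto
  hence "a + b \<in> K (max m n)" "a * b \<in> K (max m n)"
    by (simp_all add: subfield_add[OF K] subfield_mult[OF K])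
  thus "a + b \<in> (\<Union>n. K n)" "a * b \<in> (\<Union>n. K n)" by blast+
qed (use subfield_one[OF K] subfield_uminus[OF K] subfield_inverse[OF K] in blast)+

lemma subfield_adjoin: "subfield (adjoin F S) CC"
  unfolding adjoin_def by (rule field.generate_field_is_subfield[OF field_CC]) simp

lemma subset_adjoin: "F \<subseteq> adjoin F S" "S \<subseteq> adjoin F S"
  unfolding adjoin_def by (auto intro: generate_field.incl)

lemma mem_adjoin: "z \<in> adjoin F {z}"
  using subset_adjoin(2) by blast

lemma adjoin_subset_iff:
  assumes "subfield G CC"
  shows "adjoin F S \<subseteq> G \<longleftrightarrow> F \<subseteq> G \<and> S \<subseteq> G"
proof
  show "F \<subseteq> G \<and> S \<subseteq> G" if "adjoin F S \<subseteq> G"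
    using that subset_adjoin by blast
  show "adjoin F S \<subseteq> G" if "F \<subseteq> G \<and> S \<subseteq> G"
    unfolding adjoin_def
    using that field.generate_field_min_subfield1[OF field_CC, of "F \<union> S" G] assms by auto
qed

lemma adjoin_Rats_subset_iff: "subfield G CC \<Longrightarrow> adjoin \<rat> S \<subseteq> G \<longleftrightarrow> S \<subseteq> G"
  by (simp add: adjoin_subset_iff Rats_subset_subfield)

lemma adjoin_absorb: "subfield F CC \<Longrightarrow> S \<subseteq> F \<Longrightarrow> adjoin F S = F"
  using adjoin_subset_iff[of F F S] subset_adjoin(1)[of F S] by auto

lemma adjoin_eq_if_same_subfields:
  assumes "\<And>G. subfield G CC \<Longrightarrow> F \<subseteq> G \<and> S \<subseteq> G \<longleftrightarrow> F' \<subseteq> G \<and> S' \<subseteq> G"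
  shows "adjoin F S = adjoin F' S'"
proof (rule equalityI)
  show "adjoin F S \<subseteq> adjoin F' S'"
    using assms[of "adjoin F' S'"] by (simp add: adjoin_subset_iff subfield_adjoin subset_adjoin)
  show "adjoin F' S' \<subseteq> adjoin F S"
    using assms[of "adjoin F S"] by (simp add: adjoin_subset_iff subfield_adjoin subset_adjoin)
qed

lemma adjoin_adjoin: "adjoin F (adjoin A S) = adjoin (adjoin F A) S"
  by (rule adjoin_eq_if_same_subfields) (auto simp: adjoin_subset_iff)

lemma adjoin_insert: "adjoin F {a, b} = adjoin (adjoin F {a}) {b}"
  by (rule adjoin_eq_if_same_subfields) (auto simp: adjoin_subset_iff)

lemma adjoin_eqI:
  assumes "S \<subseteq> adjoin F T" "T \<subseteq> adjoin F S"
  shows "adjoin F S = adjoin F T"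
  using assms
  by (intro equalityI) (simp_all add: adjoin_subset_iff subfield_adjoin subset_adjoin(1))

lemma adjoin_eq_if_square_eq:
  assumes "z\<^sup>2 = w\<^sup>2"
  shows "adjoin F {z} = adjoin F {w}"
proof -
  have "z = w \<or> z = - w" using assms by (simp add: power2_eq_iff)
  moreover have "adjoin F {- w} = adjoin F {w}"
    using subfield_uminus[OF subfield_adjoin mem_adjoin, of w F]
      subfield_uminus[OF subfield_adjoin mem_adjoin, of "- w" F]
    by (intro adjoin_eqI) auto
  ultimately show ?thesis by blast
qed

lemma Rats_sqrt_of_intE:
  fixes b :: "'a :: field_char_0"
  assumes "b \<in> \<rat>" "b\<^sup>2 = of_int k"
  obtains a :: int where "b = of_int a" "k = a\<^sup>2"
proof -
  have "algebraic_int b"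
    by (rule algebraic_int_root[of "of_int k" "monom 1 2"])
       (use assms(2) in \<open>auto simp: poly_monom degree_monom_eq\<close>)
  hence "b \<in> \<int>" using assms(1) by (rule rational_algebraic_int_is_int)
  then obtain a :: int where "b = of_int a" by (rule Ints_cases)
  moreover from this have "k = a\<^sup>2" using assms(2) by (metis of_int_eq_iff of_int_power)
  ultimately show ?thesis by (rule that)
qed

lemma int_square_not_between:
  fixes a b :: int
  assumes "0 \<le> b" "b\<^sup>2 < k" "k < (b + 1)\<^sup>2"
  shows "k \<noteq> a\<^sup>2"
proof
  assume "k = a\<^sup>2"
  hence "b\<^sup>2 < \<bar>a\<bar>\<^sup>2" "\<bar>a\<bar>\<^sup>2 < (b + 1)\<^sup>2" using assms by simp_all
  hence "b < \<bar>a\<bar>" "\<bar>a\<bar> < b + 1"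
    using power2_less_imp_less[of b "\<bar>a\<bar>"] power2_less_imp_less[of "\<bar>a\<bar>" "b + 1"] assms(1) by auto
  thus False by simp
qed

section \<open>Quadratic extensions\<close>

lemma subfield_sqrt_combinations:
  assumes E: "subfield E CC" and z: "z\<^sup>2 \<in> E"
  shows "subfield {a + b * z | a b. a \<in> E \<and> b \<in> E} CC" (is "subfield ?S CC")
proof (rule subfield_CC_I)
  have S: "a + b * z \<in> ?S" if "a \<in> E" "b \<in> E" for a b using that by blast
  show "1 \<in> ?S" using S[of 1 0] E by (simp add: subfield_closed)
  fix c assume "c \<in> ?S"
  then obtain a b where c: "c = a + b * z" "a \<in> E" "b \<in> E" by blast
  show "- c \<in> ?S" using S[of "- a" "- b"] c E by (simp add: subfield_closed)
  show "inverse c \<in> ?S" if "c \<noteq> 0"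
  proof -
    define n where "n = a\<^sup>2 - b\<^sup>2 * z\<^sup>2"
    have n: "n \<in> E" "c * (a - b * z) = n"
      using c E z by (simp_all add: n_def subfield_closed algebra_simps power2_eq_square)
    show ?thesis
    proof (cases "n = 0")
      case True
      hence "c = 2 * a" using n(2) \<open>c \<noteq> 0\<close> c(1) by simp
      thus ?thesis using S[of "inverse (2 * a)" 0] c(2) E by (simp add: subfield_closed)
    next
      case False
      have "inverse c = (a - b * z) / n" using n(2) False \<open>c \<noteq> 0\<close> by (simp add: field_simps)
      also have "\<dots> = a / n + (- b / n) * z" by (simp add: diff_divide_distrib)
      finally show ?thesis using S[of "a / n" "- b / n"] c n(1) E by (simp add: subfield_closed)
    qed
  qed
  fix d assume "d \<in> ?S"
  then obtain a' b' where d: "d = a' + b' * z" "a' \<in> E" "b' \<in> E" by blast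
  have sum: "c + d = (a + a') + (b + b') * z" by (simp add: c d algebra_simps)
  show "c + d \<in> ?S" unfolding sum using c d E by (intro S) (simp_all add: subfield_closed)
  have prod: "c * d = (a * a' + b * b' * z\<^sup>2) + (a * b' + b * a') * z"
    by (simp add: c d algebra_simps power2_eq_square)
  show "c * d \<in> ?S" unfolding prod using c d E z by (intro S) (simp_all add: subfield_closed)
qed

lemma adjoin_sqrt_eq:
  assumes E: "subfield E CC" and z: "z\<^sup>2 \<in> E"
  shows "adjoin E {z} = {a + b * z | a b. a \<in> E \<and> b \<in> E}" (is "_ = ?S")
proof (rule equalityI)
  have "a + b * z \<in> ?S" if "a \<in> E" "b \<in> E" for a b using that by blast
  from this[of _ 0] this[of 0 1] have "E \<subseteq> ?S" "{z} \<subseteq> ?S" using E by (auto simp: subfield_closed)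
  thus "adjoin E {z} \<subseteq> ?S" by (simp add: adjoin_subset_iff subfield_sqrt_combinations E z)
  show "?S \<subseteq> adjoin E {z}"
    using subset_adjoin(1)[of E] mem_adjoin[of z E]
    by (auto intro!: subfield_closed subfield_adjoin)
qed

locale sqrt_extension =
  fixes E :: "complex set" and z :: complex
  assumes subfield: "subfield E CC" and square_mem: "z\<^sup>2 \<in> E" and notin: "z \<notin> E"
begin

lemma adjoinE:
  assumes "c \<in> adjoin E {z}"
  obtains a b where "a \<in> E" "b \<in> E" "c = a + b * z"
  using assms adjoin_sqrt_eq[OF subfield square_mem] by blast

lemma coordinates_unique:
  assumes eq: "a + b * z = a' + b' * z" and mem: "a \<in> E" "b \<in> E" "a' \<in> E" "b' \<in> E"
  shows "a = a' \<and> b = b'"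
proof -
  have "b = b'"
  proof (rule ccontr)
    assume "b \<noteq> b'"
    moreover have "(b - b') * z = a' - a" using eq by (simp add: algebra_simps)
    ultimately have "z = (a' - a) / (b - b')" by (simp add: field_simps)
    thus False using notin mem subfield by (metis subfield_diff subfield_divide)
  qed
  thus ?thesis using eq by simp
qed

lemma intermediate_cases:
  assumes G: "subfield G CC" "E \<subseteq> G" "G \<subseteq> adjoin E {z}"
  shows "G = E \<or> G = adjoin E {z}"
proof (cases "G \<subseteq> E")
  case False
  then obtain c where c: "c \<in> G" "c \<notin> E" by blast
  then obtain a b where ab: "a \<in> E" "b \<in> E" "c = a + b * z" using G(3) by (blast elim: adjoinE)
  hence "b \<noteq> 0" using c(2) by auto
  hence "z = (c - a) / b" using ab(3) by simp
  hence "z \<in> G" using ab(1,2) c(1) G by (metis subfield_diff subfield_divide subsetD)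
  thus ?thesis using G by (simp add: adjoin_subset_iff subset_antisym)
qed (use G(2) in blast)

lemma sqrt_mult_mem:
  assumes c: "c \<in> adjoin E {z}" "c\<^sup>2 \<in> E" "c \<notin> E"
  shows "c * z \<in> E"
proof -
  obtain a b where ab: "a \<in> E" "b \<in> E" "c = a + b * z" using c(1) by (rule adjoinE)
  have "(a\<^sup>2 + b\<^sup>2 * z\<^sup>2) + (2 * a * b) * z = c\<^sup>2 + 0 * z"
    by (simp add: ab(3) algebra_simps power2_eq_square)
  from coordinates_unique[OF this] have "2 * a * b = 0"
    using ab(1,2) c(2) subfield square_mem by (simp add: subfield_closed)
  moreover have "b \<noteq> 0" using ab(1,3) c(3) by auto
  ultimately have "c * z = b * z\<^sup>2" by (simp add: ab(3) power2_eq_square)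
  thus ?thesis using ab(2) subfield square_mem by (simp add: subfield_mult)
qed

text \<open>For \<open>c = a + b z\<close>, the witnesses are the norm \<open>a\<^sup>2 - b\<^sup>2 z\<^sup>2\<close> and the trace \<open>2 a\<close>.\<close>

lemma square_norm_trace:
  assumes c: "c \<in> adjoin E {z}" "c\<^sup>2 = \<alpha> + \<beta> * z" and mem: "\<alpha> \<in> E" "\<beta> \<in> E"
  obtains d t where "d \<in> E" "t \<in> E" "d\<^sup>2 = \<alpha>\<^sup>2 - \<beta>\<^sup>2 * z\<^sup>2" "t\<^sup>2 = 2 * (\<alpha> + d)"
proof -
  obtain a b where ab: "a \<in> E" "b \<in> E" "c = a + b * z" using c(1) by (rule adjoinE)
  have "(a\<^sup>2 + b\<^sup>2 * z\<^sup>2) + (2 * a * b) * z = \<alpha> + \<beta> * z"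
    unfolding c(2)[symmetric] by (simp add: ab(3) algebra_simps power2_eq_square)
  from coordinates_unique[OF this] have \<alpha>\<beta>: "\<alpha> = a\<^sup>2 + b\<^sup>2 * z\<^sup>2" "\<beta> = 2 * a * b"
    using ab(1,2) mem subfield square_mem by (simp_all add: subfield_closed)
  have "a\<^sup>2 - b\<^sup>2 * z\<^sup>2 \<in> E" "2 * a \<in> E"
    using ab(1,2) subfield square_mem by (simp_all add: subfield_closed)
  moreover have "(a\<^sup>2 - b\<^sup>2 * z\<^sup>2)\<^sup>2 = \<alpha>\<^sup>2 - \<beta>\<^sup>2 * z\<^sup>2" "(2 * a)\<^sup>2 = 2 * (\<alpha> + (a\<^sup>2 - b\<^sup>2 * z\<^sup>2))"
    by (simp_all add: \<alpha>\<beta> algebra_simps power2_eq_square)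
  ultimately show ?thesis by (rule that)
qed

end

definition quadext :: "complex set \<Rightarrow> complex set \<Rightarrow> bool" where
  "quadext E K \<longleftrightarrow> (\<exists>z. sqrt_extension E z \<and> K = adjoin E {z})"

lemma quadext_adjoin: "sqrt_extension E z \<Longrightarrow> quadext E (adjoin E {z})"
  unfolding quadext_def by blast

lemma quadextE:
  assumes "quadext E K"
  obtains z where "sqrt_extension E z" "K = adjoin E {z}"
  using assms unfolding quadext_def by blast

lemma quadext_subfield:
  assumes "quadext E K"
  shows "subfield E CC" "subfield K CC"
  using assms sqrt_extension.subfield subfield_adjoin by (auto elim: quadextE)

lemma quadext_psubset:
  assumes "quadext E K"
  shows "E \<subset> K"
  using assms subset_adjoin(1) mem_adjoin sqrt_extension.notin by (blast elim: quadextE)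

lemma quadext_intermediate_cases:
  assumes "quadext E K" "subfield G CC" "E \<subseteq> G" "G \<subseteq> K"
  shows "G = E \<or> G = K"
  using assms sqrt_extension.intermediate_cases by (blast elim: quadextE)

lemma quadext_base_unique:
  assumes "quadext F K" "quadext E K" "F \<subseteq> E"
  shows "E = F"
  using quadext_intermediate_cases[OF assms(1) quadext_subfield(1)[OF assms(2)] assms(3)]
    quadext_psubset[OF assms(2)] by blast

subsection \<open>Involutions\<close>

definition fixed_field :: "complex set \<Rightarrow> (complex \<Rightarrow> complex) \<Rightarrow> complex set" where
  "fixed_field K \<sigma> = {a \<in> K. \<sigma> a = a}"

locale subfield_embedding =
  fixes K :: "complex set" and \<sigma> :: "complex \<Rightarrow> complex"
  assumes subfield: "subfield K CC" and hom: "\<sigma> \<in> ring_hom (CC\<lparr>carrier := K\<rparr>) CC"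
begin

lemma hom_one: "\<sigma> 1 = 1"
  and hom_add: "a \<in> K \<Longrightarrow> b \<in> K \<Longrightarrow> \<sigma> (a + b) = \<sigma> a + \<sigma> b"
  and hom_mult: "a \<in> K \<Longrightarrow> b \<in> K \<Longrightarrow> \<sigma> (a * b) = \<sigma> a * \<sigma> b"
  using hom unfolding ring_hom_def by auto

lemma hom_uminus: "a \<in> K \<Longrightarrow> \<sigma> (- a) = - \<sigma> a"
  using hom_add[of 0 0] hom_add[of a "- a"] subfield
  by (simp add: subfield_closed eq_neg_iff_add_eq_0 add.commute)

lemma hom_inverse: "a \<in> K \<Longrightarrow> a \<noteq> 0 \<Longrightarrow> \<sigma> (inverse a) = inverse (\<sigma> a)"
  using hom_mult[of a "inverse a"] subfield hom_one by (simp add: subfield_closed inverse_unique)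

lemma hom_square: "a \<in> K \<Longrightarrow> \<sigma> (a\<^sup>2) = (\<sigma> a)\<^sup>2"
  by (simp add: power2_eq_square hom_mult)

lemma subfield_fixed_field: "subfield (fixed_field K \<sigma>) CC"
  unfolding fixed_field_def using subfield
  by (intro subfield_CC_I)
     (auto simp: subfield_closed hom_one hom_add hom_mult hom_uminus hom_inverse)

lemma subfield_vimage: "subfield G CC \<Longrightarrow> subfield {a \<in> K. \<sigma> a \<in> G} CC"
  using subfield
  by (intro subfield_CC_I)
     (auto simp: subfield_closed hom_one hom_add hom_mult hom_uminus hom_inverse)

lemma hom_Rats: "a \<in> \<rat> \<Longrightarrow> \<sigma> a = a"
  using Rats_subset_subfield[OF subfield_fixed_field] by (auto simp: fixed_field_def)

lemma hom_sqrt_cases: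
  assumes "z \<in> K" "z\<^sup>2 \<in> fixed_field K \<sigma>"
  shows "\<sigma> z = z \<or> \<sigma> z = - z"
proof -
  have "(\<sigma> z)\<^sup>2 = z\<^sup>2" using assms hom_square[of z] by (simp add: fixed_field_def)
  thus ?thesis by (simp add: power2_eq_iff)
qed

end

locale field_involution = subfield_embedding K \<tau> for K \<tau> +
  assumes closed: "a \<in> K \<Longrightarrow> \<tau> a \<in> K" and involutive: "a \<in> K \<Longrightarrow> \<tau> (\<tau> a) = a"
begin

lemma mult_conj_fixed: "a \<in> K \<Longrightarrow> a * \<tau> a \<in> fixed_field K \<tau>"
  by (simp add: fixed_field_def subfield_mult subfield closed hom_mult involutive mult.commute)

lemma add_conj_fixed: "a \<in> K \<Longrightarrow> a + \<tau> a \<in> fixed_field K \<tau>"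
  by (simp add: fixed_field_def subfield_add subfield closed hom_add involutive add.commute)

end

context sqrt_extension
begin

definition conjugate :: "complex \<Rightarrow> complex" where
  "conjugate c = (THE d. \<exists>a\<in>E. \<exists>b\<in>E. c = a + b * z \<and> d = a - b * z)"

lemma conjugate_eq: "a \<in> E \<Longrightarrow> b \<in> E \<Longrightarrow> conjugate (a + b * z) = a - b * z"
  unfolding conjugate_def by (rule the_equality) (use coordinates_unique in blast)+

lemma field_involution_conjugate: "field_involution (adjoin E {z}) conjugate"
proof (intro field_involution.intro subfield_embedding.intro field_involution_axioms.intro
    subfield_adjoin)
  have coords: "a + b * z \<in> adjoin E {z}" if "a \<in> E" "b \<in> E" for a b
    using that adjoin_sqrt_eq[OF subfield square_mem] by blast
  have closed: "conjugate c \<in> adjoin E {z} \<and> conjugate (conjugate c) = c"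
    if c: "c \<in> adjoin E {z}" for c
  proof -
    obtain a b where ab: "a \<in> E" "b \<in> E" "c = a + b * z" using c by (rule adjoinE)
    have "conjugate c = a + (- b) * z" using ab conjugate_eq by simp
    thus ?thesis using ab coords[of a "- b"] conjugate_eq[of a "- b"] subfield
      by (simp add: subfield_closed)
  qed
  show "conjugate c \<in> adjoin E {z}" "conjugate (conjugate c) = c" if "c \<in> adjoin E {z}" for c
    using closed[OF that] by auto
  have "conjugate (c + d) = conjugate c + conjugate d \<and>
      conjugate (c * d) = conjugate c * conjugate d"
    if cd: "c \<in> adjoin E {z}" "d \<in> adjoin E {z}" for c d
  proof -
    obtain a b where c: "a \<in> E" "b \<in> E" "c = a + b * z" using cd(1) by (rule adjoinE)
    obtain a' b' where d: "a' \<in> E" "b' \<in> E" "d = a' + b' * z" using cd(2) by (rule adjoinE)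
    have sum: "c + d = (a + a') + (b + b') * z" by (simp add: c d algebra_simps)
    have "conjugate (c + d) = (a + a') - (b + b') * z"
      unfolding sum using c d subfield by (intro conjugate_eq) (simp_all add: subfield_closed)
    moreover have prod: "c * d = (a * a' + b * b' * z\<^sup>2) + (a * b' + b * a') * z"
      by (simp add: c d algebra_simps power2_eq_square)
    have "conjugate (c * d) = (a * a' + b * b' * z\<^sup>2) - (a * b' + b * a') * z"
      unfolding prod using c d subfield square_mem
      by (intro conjugate_eq) (simp_all add: subfield_closed)
    ultimately show ?thesis
      using c d by (simp add: conjugate_eq) (simp add: algebra_simps power2_eq_square)
  qed
  moreover have "conjugate 1 = 1" using conjugate_eq[of 1 0] subfield by (simp add: subfield_closed)
  ultimately show "conjugate \<in> ring_hom (CC\<lparr>carrier := adjoin E {z}\<rparr>) CC"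
    by (intro ring_hom_memI) auto
qed

lemma fixed_field_conjugate: "fixed_field (adjoin E {z}) conjugate = E"
proof (intro equalityI subsetI)
  fix c assume "c \<in> fixed_field (adjoin E {z}) conjugate"
  hence c: "c \<in> adjoin E {z}" "conjugate c = c" by (auto simp: fixed_field_def)
  obtain a b where ab: "a \<in> E" "b \<in> E" "c = a + b * z" using c(1) by (rule adjoinE)
  hence "b * z = 0" using c(2) conjugate_eq by simp
  thus "c \<in> E" using ab by auto
next
  fix c assume "c \<in> E"
  thus "c \<in> fixed_field (adjoin E {z}) conjugate"
    using conjugate_eq[of c 0] subset_adjoin(1)[of E] subfield
    by (auto simp: fixed_field_def subfield_zero)
qed

end

lemma quadext_involution:
  assumes "quadext E K"
  obtains \<tau> where "field_involution K \<tau>" "fixed_field K \<tau> = E"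
proof -
  obtain z where "sqrt_extension E z" "K = adjoin E {z}" using assms by (rule quadextE)
  thus ?thesis
    using that sqrt_extension.field_involution_conjugate sqrt_extension.fixed_field_conjugate
    by blast
qed

subsection \<open>Biquadratic extensions\<close>

locale biquadratic_extension =
  fixes F :: "complex set" and p q :: complex
  assumes sqrt_extension_fst: "sqrt_extension F p" and sqrt_extension_snd: "sqrt_extension F q"
    and mult_notin: "p * q \<notin> F"
begin

lemma subfield: "subfield F CC"
  by (rule sqrt_extension.subfield[OF sqrt_extension_fst])

lemma swap: "biquadratic_extension F q p"
  using sqrt_extension_fst sqrt_extension_snd mult_notin
  by (simp add: biquadratic_extension_def mult.commute)

lemma nonzero: "p \<noteq> 0" "q \<noteq> 0"
  using mult_notin subfield_zero[OF subfield] by auto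

lemma fst_mult: "biquadratic_extension F p (p * q)"
proof (intro biquadratic_extension.intro sqrt_extension_fst)
  have squares: "p\<^sup>2 \<in> F" "q\<^sup>2 \<in> F"
    using sqrt_extension.square_mem sqrt_extension_fst sqrt_extension_snd by blast+
  thus "sqrt_extension F (p * q)"
    using subfield mult_notin
    by (intro sqrt_extension.intro) (auto simp: power_mult_distrib subfield_mult)
  show "p * (p * q) \<notin> F"
  proof
    assume "p * (p * q) \<in> F"
    hence "p * (p * q) / p\<^sup>2 \<in> F" using squares by (intro subfield_divide subfield)
    thus False using sqrt_extension.notin[OF sqrt_extension_snd] nonzero
      by (simp add: power2_eq_square)
  qed
qed

lemma adjoin_fst_mult: "adjoin F {p * q, p} = adjoin F {p, q}"
proof (rule adjoin_eqI)
  have mem: "p \<in> adjoin F {p, q}" "q \<in> adjoin F {p, q}" "p * q \<in> adjoin F {p * q, p}"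
    "p \<in> adjoin F {p * q, p}"
    using subset_adjoin(2) by blast+
  have "p * q / p \<in> adjoin F {p * q, p}" by (intro subfield_divide subfield_adjoin mem)
  thus "{p, q} \<subseteq> adjoin F {p * q, p}" using mem nonzero by simp
  show "{p * q, p} \<subseteq> adjoin F {p, q}" using mem by (simp add: subfield_mult subfield_adjoin)
qed

lemma snd_notin: "q \<notin> adjoin F {p}"
  using sqrt_extension.sqrt_mult_mem[OF sqrt_extension_fst, of q] mult_notin
    sqrt_extension.square_mem[OF sqrt_extension_snd] sqrt_extension.notin[OF sqrt_extension_snd]
  by (auto simp: mult.commute)

lemma quadext_fst: "quadext (adjoin F {p}) (adjoin F {p, q})"
proof -
  have "q\<^sup>2 \<in> adjoin F {p}"
    using sqrt_extension.square_mem[OF sqrt_extension_snd] subset_adjoin(1) by blast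
  hence "sqrt_extension (adjoin F {p}) q" using subfield_adjoin snd_notin
    by (intro sqrt_extension.intro)
  thus ?thesis unfolding adjoin_insert by (rule quadext_adjoin)
qed

lemma quadext_snd: "quadext (adjoin F {q}) (adjoin F {p, q})"
  using biquadratic_extension.quadext_fst[OF swap] by (simp add: insert_commute)

lemma quadext_mult: "quadext (adjoin F {p * q}) (adjoin F {p, q})"
  using biquadratic_extension.quadext_snd[OF fst_mult] adjoin_fst_mult by (simp add: insert_commute)

lemma distinct_adjoin: "distinct [adjoin F {p}, adjoin F {q}, adjoin F {p * q}]"
proof -
  have "adjoin F {a} \<noteq> adjoin F {b}" if "biquadratic_extension F a b" for a b
    using biquadratic_extension.snd_notin[OF that] mem_adjoin[of b F] by blast
  from this[OF biquadratic_extension_axioms] this[OF fst_mult]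
    this[OF biquadratic_extension.fst_mult[OF swap]]
  show ?thesis by (simp add: mult.commute)
qed

lemma index_two_iff:
  assumes FE: "F \<subseteq> E"
  shows "quadext E (adjoin F {p, q}) \<longleftrightarrow> E \<in> {adjoin F {p}, adjoin F {q}, adjoin F {p * q}}"
proof
  let ?T = "adjoin F {p, q}"
  assume E: "quadext E ?T"
  then obtain \<tau> where \<tau>: "field_involution ?T \<tau>" and fixed: "fixed_field ?T \<tau> = E"
    by (rule quadext_involution)
  interpret \<tau>: field_involution ?T \<tau> by (rule \<tau>)
  have pq: "p \<in> ?T" "q \<in> ?T" using subset_adjoin(2) by blast+
  have "p\<^sup>2 \<in> E" "q\<^sup>2 \<in> E"
    using FE sqrt_extension.square_mem sqrt_extension_fst sqrt_extension_snd by blast+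
  hence "\<tau> p = p \<or> \<tau> p = - p" "\<tau> q = q \<or> \<tau> q = - q"
    using pq fixed \<tau>.hom_sqrt_cases by blast+
  moreover have "p * q \<in> ?T" "\<tau> (p * q) = \<tau> p * \<tau> q"
    using pq by (simp_all add: \<tau>.hom_mult subfield_mult subfield_adjoin)
  ultimately have "p \<in> E \<or> q \<in> E \<or> p * q \<in> E"
    using pq by (auto simp: fixed_field_def simp flip: fixed)
  moreover have "E = adjoin F {a}" if "a \<in> E" "quadext (adjoin F {a}) ?T" for a
    using that FE E by (intro quadext_base_unique) (auto simp: adjoin_subset_iff quadext_subfield)
  ultimately show "E \<in> {adjoin F {p}, adjoin F {q}, adjoin F {p * q}}"
    using quadext_fst quadext_snd quadext_mult by blast
qed (use quadext_fst quadext_snd quadext_mult in auto)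

end

subsection \<open>Degrees\<close>

lemma line_extension_CC: "CC.line_extension K a E = {k * a + v | k v. k \<in> K \<and> v \<in> E}"
  using CC.line_extension_mem_iff[of _ K a E] by auto

lemma Span_one: "CC.Span F [1] = F"
  by (simp add: line_extension_CC)

lemma has_degree_self: "subfield F CC \<Longrightarrow> has_degree F F 1"
  unfolding has_degree_def using CC.dimension_one by blast

lemma has_degree_unique: "subfield F CC \<Longrightarrow> has_degree E F m \<Longrightarrow> has_degree E F n \<Longrightarrow> m = n"
  unfolding has_degree_def using CC.dimension_is_inj by blast

lemma has_degree_mono:
  assumes "subfield F CC" "has_degree E F m" "has_degree K F n" "E \<subseteq> K"
  shows "m \<le> n"
proof -
  obtain Vs where Vs: "set Vs \<subseteq> carrier CC" "CC.independent F Vs" "length Vs = m" "CC.Span F Vs = E"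
    using CC.exists_base[of F m E] assms unfolding has_degree_def by blast
  have "set Vs \<subseteq> E" using CC.Span_base_incl[OF assms(1) Vs(1)] Vs(4) by simp
  thus ?thesis using CC.independent_length_le_dimension[of F n K Vs] assms Vs
    unfolding has_degree_def by auto
qed

lemma quadext_imp_has_degree_2:
  assumes "quadext F E"
  shows "has_degree E F 2"
proof -
  obtain z where "sqrt_extension F z" and E: "E = adjoin F {z}" using assms by (rule quadextE)
  then interpret sqrt_extension F z by simp
  have "CC.dimension (Suc 1) F (CC.line_extension F z F)"
    using CC.Suc_dim[of z F 1 F] CC.dimension_one[OF subfield] notin by simp
  moreover have "CC.line_extension F z F = E"
    unfolding line_extension_CC E adjoin_sqrt_eq[OF subfield square_mem] by (auto simp: add.commute)
  ultimately show ?thesis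
    unfolding has_degree_def using quadext_psubset[OF assms] by (simp add: numeral_2_eq_2)
qed

lemma has_degree_2_eq_span:
  assumes F: "subfield F CC" and E: "subfield E CC" and deg: "has_degree E F 2"
    and \<theta>: "\<theta> \<in> E" "\<theta> \<notin> F"
  shows "E = {k * \<theta> + v | k v. k \<in> F \<and> v \<in> F}"
proof -
  have "CC.independent F [\<theta>, 1]"
    by (intro CC.li_Cons CC.li_Nil) (use Span_one \<theta> F in \<open>auto simp: subfield_zero\<close>)
  moreover have "set [\<theta>, 1] \<subseteq> E" using \<theta> E by (simp add: subfield_one)
  ultimately have "E = CC.Span F [\<theta>, 1]"
    using CC.independent_length_eq_dimension[OF F, of 2 E "[\<theta>, 1]"] deg
    unfolding has_degree_def by auto
  also have "\<dots> = CC.line_extension F \<theta> (CC.Span F [1])" by simp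
  finally show ?thesis by (simp only: Span_one line_extension_CC)
qed

lemma has_degree_2_imp_quadext:
  assumes F: "subfield F CC" and E: "subfield E CC" and deg: "has_degree E F 2"
  shows "quadext F E"
proof -
  have FE: "F \<subseteq> E" using deg by (simp add: has_degree_def)
  moreover have "E \<noteq> F" using has_degree_unique[OF F deg, of 1] has_degree_self[OF F] by auto
  ultimately obtain \<theta> where \<theta>: "\<theta> \<in> E" "\<theta> \<notin> F" by blast
  have E_eq: "E = {k * \<theta> + v | k v. k \<in> F \<and> v \<in> F}" by (rule has_degree_2_eq_span[OF F E deg \<theta>])
  have "\<theta>\<^sup>2 \<in> E" using \<theta> E by (simp add: subfield_power)
  then obtain k v where kv: "k \<in> F" "v \<in> F" "\<theta>\<^sup>2 = k * \<theta> + v" using E_eq by blast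
  define z where "z = \<theta> - k / 2"
  have \<theta>_eq: "\<theta> = z + k / 2" by (simp add: z_def)
  have "z\<^sup>2 = v + k\<^sup>2 / 4" using kv(3) by (simp add: z_def algebra_simps power2_eq_square)
  moreover have "z \<notin> F" using \<theta>(2) kv(1) F by (auto simp: \<theta>_eq subfield_closed)
  ultimately have "sqrt_extension F z"
    using F kv(1,2) by (intro sqrt_extension.intro) (auto simp: subfield_closed)
  moreover have "E = adjoin F {z}"
  proof (rule equalityI)
    have "F \<subseteq> adjoin F {z}" "z \<in> adjoin F {z}" by (rule subset_adjoin mem_adjoin)+
    thus "E \<subseteq> adjoin F {z}" using kv(1)
      by (auto simp: E_eq \<theta>_eq intro!: subfield_closed subfield_adjoin)
    have "z \<in> E" using \<theta>(1) kv(1) FE E by (auto simp: z_def intro!: subfield_closed)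
    thus "adjoin F {z} \<subseteq> E" using FE E by (simp add: adjoin_subset_iff)
  qed
  ultimately show ?thesis unfolding quadext_def by blast
qed

lemma quadext_iff_has_degree_2:
  "subfield F CC \<Longrightarrow> subfield E CC \<Longrightarrow> quadext F E \<longleftrightarrow> has_degree E F 2"
  using quadext_imp_has_degree_2 has_degree_2_imp_quadext by blast

lemma has_degree_quadext:
  assumes "subfield F CC" "has_degree E F n" "quadext E K"
  shows "has_degree K F (2 * n)"
proof -
  have "CC.dimension (n * 2) F K"
    using CC.telescopic_base[of F E n 2 K] assms quadext_subfield[of E K]
      quadext_imp_has_degree_2[of E K] unfolding has_degree_def by blast
  thus ?thesis using assms quadext_psubset[of E K] unfolding has_degree_def
    by (auto simp: mult.commute)
qed

subsection \<open>Iterated quadratic extensions\<close>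

inductive quadratic_tower :: "complex set \<Rightarrow> bool" where
  Rats: "quadratic_tower \<rat>"
| adjoin_sqrt: "quadratic_tower A \<Longrightarrow> z\<^sup>2 \<in> A \<Longrightarrow> quadratic_tower (adjoin A {z})"

lemma quadratic_tower_subfield: "quadratic_tower A \<Longrightarrow> subfield A CC"
  by (induction rule: quadratic_tower.induct) (auto simp: subfield_Rats subfield_adjoin)

lemma quadratic_tower_quadext:
  assumes "quadratic_tower A" "quadext A B"
  shows "quadratic_tower B"
  using assms(2) quadratic_tower.adjoin_sqrt[OF assms(1)] sqrt_extension.square_mem
  by (blast elim: quadextE)

lemma quadratic_tower_finite_degree:
  assumes "quadratic_tower T"
  shows "\<exists>d>0. has_degree T \<rat> d"
  using assms
proof induction
  case Rats
  show ?case using has_degree_self[OF subfield_Rats] by auto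
next
  case (adjoin_sqrt A z)
  then obtain d where d: "d > 0" "has_degree A \<rat> d" by blast
  have A: "subfield A CC" by (rule quadratic_tower_subfield[OF adjoin_sqrt.hyps(1)])
  show ?case
  proof (cases "z \<in> A")
    case True
    thus ?thesis using d adjoin_absorb[OF A] by auto
  next
    case False
    hence "quadext A (adjoin A {z})" using A adjoin_sqrt.hyps
      by (intro quadext_adjoin sqrt_extension.intro)
    thus ?thesis using has_degree_quadext[OF subfield_Rats d(2)] d(1)
      by (intro exI[of _ "2 * d"]) auto
  qed
qed

text \<open>When the successive square roots that generate \<open>A\<close> are adjoined to \<open>F\<close>, the last step that
  is not trivial is a quadratic extension.\<close>

lemma adjoin_quadratic_tower_quadext:
  assumes "quadratic_tower A" "subfield F CC" "adjoin F A \<noteq> F"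
  shows "\<exists>E. F \<subseteq> E \<and> quadext E (adjoin F A)"
  using assms
proof (induction rule: quadratic_tower.induct)
  case Rats
  thus ?case using adjoin_absorb[of F \<rat>] Rats_subset_subfield[of F] by auto
next
  case (adjoin_sqrt A z)
  let ?B = "adjoin F A"
  have step: "adjoin F (adjoin A {z}) = adjoin ?B {z}" by (rule adjoin_adjoin)
  show ?case
  proof (cases "z \<in> ?B")
    case True
    hence "adjoin ?B {z} = ?B" using adjoin_absorb[OF subfield_adjoin] by simp
    thus ?thesis using adjoin_sqrt step by simp
  next
    case False
    moreover have "z\<^sup>2 \<in> ?B" using adjoin_sqrt.hyps subset_adjoin(2)[of A F] by blast
    ultimately have "quadext ?B (adjoin ?B {z})"
      by (intro quadext_adjoin sqrt_extension.intro subfield_adjoin)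
    thus ?thesis unfolding step using subset_adjoin(1)[of F A] by blast
  qed
qed

lemma quadratic_tower_index_two:
  assumes "quadratic_tower T" "subfield F CC" "F \<subset> T"
  obtains E where "F \<subseteq> E" "quadext E T"
proof -
  have "adjoin F T = T"
    using assms quadratic_tower_subfield[OF assms(1)] subset_adjoin(2)[of T F]
    by (intro equalityI) (auto simp: adjoin_subset_iff)
  thus ?thesis using that adjoin_quadratic_tower_quadext[OF assms(1,2)] assms(3) by auto
qed

definition index_two_closed :: "complex set set \<Rightarrow> bool" where
  "index_two_closed \<S> \<longleftrightarrow> (\<forall>T\<in>\<S>. quadratic_tower T \<and> (\<forall>E. quadext E T \<longrightarrow> E \<in> \<S>))"

lemma index_two_closed_subfield:
  assumes closed: "index_two_closed \<S>" and T: "T \<in> \<S>" and F: "subfield F CC" "F \<subseteq> T"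
  shows "F \<in> \<S>"
proof -
  have "F \<in> \<S>" if "has_degree T \<rat> d" for d
    using T F(2) that
  proof (induction d arbitrary: T rule: less_induct)
    case (less d)
    show ?case
    proof (cases "F = T")
      case False
      have "quadratic_tower T" using closed less.prems(1) unfolding index_two_closed_def by blast
      then obtain E where E: "F \<subseteq> E" "quadext E T"
        using quadratic_tower_index_two[OF _ F(1)] False less.prems(2) by blast
      hence "E \<in> \<S>" "quadratic_tower E" using closed less.prems(1) unfolding index_two_closed_def
        by blast+
      then obtain e where e: "e > 0" "has_degree E \<rat> e" using quadratic_tower_finite_degree by blast
      have "has_degree T \<rat> (2 * e)" by (rule has_degree_quadext[OF subfield_Rats e(2) E(2)])
      hence "2 * e = d" using has_degree_unique[OF subfield_Rats _ less.prems(3)] by blast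
      thus ?thesis using less.IH[of e E] e E(1) \<open>E \<in> \<S>\<close> by simp
    qed (use less.prems(1) in simp)
  qed
  thus ?thesis using closed T quadratic_tower_finite_degree unfolding index_two_closed_def by blast
qed

lemma index_two_closed_Union:
  fixes A B :: "nat \<Rightarrow> complex set"
  assumes closed: "index_two_closed \<S>" and A: "\<And>n. A n \<in> \<S>"
    and dichotomy: "\<And>G n. G \<in> \<S> \<Longrightarrow> G \<subseteq> A (Suc n) \<or> B n \<subseteq> G"
    and F: "subfield F CC" "F \<subseteq> (\<Union>n. A n)"
  shows "F \<in> \<S> \<or> (\<Union>n. B n) \<subseteq> F"
proof (cases "\<exists>n. F \<subseteq> A n")
  case True
  thus ?thesis using index_two_closed_subfield[OF closed A F(1)] by blast
next
  case False
  have "B n \<subseteq> F" for n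
  proof -
    obtain a m where a: "a \<in> F" "a \<notin> A (Suc n)" "a \<in> A m" using False F(2) by blast
    have "subfield (A m) CC"
      using closed A[of m] quadratic_tower_subfield unfolding index_two_closed_def by blast
    hence "F \<inter> A m \<in> \<S>" by (intro index_two_closed_subfield[OF closed A] subfield_Int F(1)) auto
    thus ?thesis using dichotomy[of "F \<inter> A m" n] a by blast
  qed
  thus ?thesis by blast
qed

section \<open>Towers of iterated square roots\<close>

definition tower_field :: "(nat \<Rightarrow> complex) \<Rightarrow> nat \<Rightarrow> complex set" where
  "tower_field x n = adjoin \<rat> {x n}"

lemma subfield_tower_field: "subfield (tower_field x n) CC"
  unfolding tower_field_def by (rule subfield_adjoin)

lemma mem_tower_field: "x n \<in> tower_field x n"
  unfolding tower_field_def by (rule mem_adjoin)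

lemma tower_field_subset_iff: "subfield F CC \<Longrightarrow> tower_field x n \<subseteq> F \<longleftrightarrow> x n \<in> F"
  unfolding tower_field_def by (simp add: adjoin_Rats_subset_iff)

locale sqrt_tower =
  fixes \<nu> x0 :: int and x :: "nat \<Rightarrow> complex"
  assumes x_0: "x 0 = of_int x0" and x_Suc: "(x (Suc n))\<^sup>2 = of_int \<nu> + x n"
begin

abbreviation K :: "nat \<Rightarrow> complex set" where "K \<equiv> tower_field x"

lemmas subfield_K = subfield_tower_field[of x]
  and x_mem_K = mem_tower_field[of x]
  and K_subset_iff = tower_field_subset_iff[of _ x]

lemma K_0: "K 0 = \<rat>"
  unfolding tower_field_def x_0 by (rule adjoin_absorb[OF subfield_Rats]) simp

lemma x_Suc_square_mem: "(x (Suc n))\<^sup>2 \<in> K n"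
  using x_mem_K[of n] subfield_K[of n] by (simp add: x_Suc subfield_closed)

lemma x_mem_if_Suc:
  assumes "subfield F CC" "x (Suc n) \<in> F"
  shows "x n \<in> F"
proof -
  have "x n = (x (Suc n))\<^sup>2 - of_int \<nu>" by (simp add: x_Suc)
  thus ?thesis using assms by (simp add: subfield_closed)
qed

lemma K_mono: "m \<le> n \<Longrightarrow> K m \<subseteq> K n"
  by (rule lift_Suc_mono_le[of K])
     (use x_mem_if_Suc[OF subfield_K x_mem_K] in \<open>simp_all add: K_subset_iff subfield_K\<close>)

lemma subfield_Union_K: "subfield (\<Union>n. K n) CC"
  by (rule subfield_chain_Union[OF K_mono subfield_K])

lemma x_mem_K_le: "m \<le> n \<Longrightarrow> x m \<in> K n"
  using K_mono x_mem_K by blast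

lemma K_Suc: "K (Suc n) = adjoin (K n) {x (Suc n)}"
proof (rule equalityI)
  show "K (Suc n) \<subseteq> adjoin (K n) {x (Suc n)}" by (simp add: K_subset_iff subfield_adjoin mem_adjoin)
  show "adjoin (K n) {x (Suc n)} \<subseteq> K (Suc n)"
    using K_mono[of n "Suc n"] by (simp add: adjoin_subset_iff subfield_K x_mem_K)
qed

lemma quadratic_tower_K: "quadratic_tower (K n)"
  by (induction n) (auto simp: K_0 K_Suc intro!: quadratic_tower.intros x_Suc_square_mem)

lemma sqrt_extension_K: "x (Suc n) \<notin> K n \<Longrightarrow> sqrt_extension (K n) (x (Suc n))"
  by (intro sqrt_extension.intro subfield_K x_Suc_square_mem)

lemma Int_K_Suc:
  assumes F: "subfield F CC" "x n \<in> F" "x (Suc n) \<notin> F"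
  shows "F \<inter> K (Suc n) = K n"
proof -
  have K_subset: "K n \<subseteq> F" using F by (simp add: K_subset_iff)
  hence ext: "sqrt_extension (K n) (x (Suc n))" using F(3) by (intro sqrt_extension_K) blast
  have "F \<inter> K (Suc n) = K n \<or> F \<inter> K (Suc n) = K (Suc n)"
    unfolding K_Suc using K_subset subset_adjoin(1)[of "K n"]
    by (intro sqrt_extension.intermediate_cases[OF ext] subfield_Int F(1) subfield_adjoin) auto
  thus ?thesis using F(3) x_mem_K[of "Suc n"] by blast
qed

text \<open>Taking norms down the tower turns \<open>u\<^sub>i - x\<^sub>j\<close> into \<open>u\<^sub>i\<^sup>2 - x\<^sub>j\<^sup>2 = u\<^sub>i\<^sub>+\<^sub>1 - x\<^sub>j\<^sub>-\<^sub>1\<close>.\<close>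

lemma u_minus_x_square_imp:
  assumes "\<And>i. i < j \<Longrightarrow> x (Suc i) \<notin> K i" "c \<in> K j" "c\<^sup>2 = of_int (u \<nu> i) - x j"
  shows "\<exists>a::int. u \<nu> (i + j) - x0 = a\<^sup>2"
  using assms
proof (induction j arbitrary: i c)
  case 0
  hence "c \<in> \<rat>" "c\<^sup>2 = of_int (u \<nu> i - x0)" by (simp_all add: K_0 x_0)
  thus ?case by (metis Rats_sqrt_of_intE add_0_right)
next
  case (Suc j)
  have c: "c \<in> adjoin (K j) {x (Suc j)}" "c\<^sup>2 = of_int (u \<nu> i) + (- 1) * x (Suc j)"
    using Suc.prems by (simp_all add: K_Suc)
  have "sqrt_extension (K j) (x (Suc j))" using Suc.prems(1) by (intro sqrt_extension_K) simp
  then obtain d where "d \<in> K j" "d\<^sup>2 = (of_int (u \<nu> i))\<^sup>2 - (- 1)\<^sup>2 * (x (Suc j))\<^sup>2"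
    using c by (rule sqrt_extension.square_norm_trace) (simp_all add: subfield_closed subfield_K)
  hence "\<exists>a::int. u \<nu> (Suc i + j) - x0 = a\<^sup>2"
    using Suc.prems(1) by (intro Suc.IH[of d]) (simp_all add: x_Suc)
  thus ?case by simp
qed

lemma norm_trace_if_x_Suc_Suc_mem:
  assumes "x (Suc n) \<notin> K n" "x (Suc (Suc n)) \<in> K (Suc n)"
  obtains d t where "d \<in> K n" "t \<in> K n" "d\<^sup>2 = of_int (u \<nu> 0) - x n" "t\<^sup>2 = 2 * (of_int \<nu> + d)"
proof -
  obtain d t where "d \<in> K n" "t \<in> K n" "d\<^sup>2 = (of_int \<nu>)\<^sup>2 - 1\<^sup>2 * (x (Suc n))\<^sup>2"
    "t\<^sup>2 = 2 * (of_int \<nu> + d)"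
    by (rule sqrt_extension.square_norm_trace[OF sqrt_extension_K[OF assms(1)],
          of "x (Suc (Suc n))" "of_int \<nu>" 1])
       (use assms(2) in \<open>simp_all add: K_Suc x_Suc subfield_closed subfield_K\<close>)
  thus ?thesis using that by (simp add: x_Suc)
qed

lemma generator_notin_predecessor:
  assumes base: "\<And>a. \<nu> + x0 \<noteq> a\<^sup>2"
    and trace: "\<And>a b. u \<nu> 0 - x0 = b\<^sup>2 \<Longrightarrow> 2 * (\<nu> + b) \<noteq> a\<^sup>2"
    and norm: "\<And>j a. j \<ge> 1 \<Longrightarrow> u \<nu> j - x0 \<noteq> a\<^sup>2"
  shows "x (Suc n) \<notin> K n"
proof (induction n rule: less_induct)
  case (less n)
  show ?case
  proof (cases n)
    case 0
    have "(x 1)\<^sup>2 = of_int (\<nu> + x0)" using x_Suc[of 0] x_0 by simp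
    hence "x 1 \<notin> \<rat>" using base by (metis Rats_sqrt_of_intE)
    thus ?thesis using 0 K_0 by simp
  next
    case (Suc m)
    show ?thesis
    proof
      assume "x (Suc n) \<in> K n"
      then obtain d t where d: "d \<in> K m" "d\<^sup>2 = of_int (u \<nu> 0) - x m"
        and t: "t \<in> K m" "t\<^sup>2 = 2 * (of_int \<nu> + d)"
        using norm_trace_if_x_Suc_Suc_mem less[of m] Suc by blast
      have "\<exists>a. u \<nu> (0 + m) - x0 = a\<^sup>2" using u_minus_x_square_imp[OF _ d] less Suc by simp
      hence m: "m = 0" using norm[of m] by (cases m) auto
      have "d \<in> \<rat>" "d\<^sup>2 = of_int (u \<nu> 0 - x0)" using d m K_0 x_0 by simp_all
      then obtain b where b: "d = of_int b" "u \<nu> 0 - x0 = b\<^sup>2" by (rule Rats_sqrt_of_intE)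
      have "t \<in> \<rat>" "t\<^sup>2 = of_int (2 * (\<nu> + b))" using t m K_0 b(1) by simp_all
      thus False using trace[OF b(2)] by (metis Rats_sqrt_of_intE)
    qed
  qed
qed

lemma conj_product_square:
  assumes \<tau>: "field_involution T \<tau>" and w: "w \<in> T" "w\<^sup>2 = c * (of_int \<nu> + x (Suc i))" and c: "c \<in> \<rat>"
    and x: "x (Suc i) \<in> T" "\<tau> (x (Suc i)) = - x (Suc i)"
  shows "(w * \<tau> w)\<^sup>2 = c\<^sup>2 * (of_int (u \<nu> 0) - x i)"
proof -
  interpret \<tau>: field_involution T \<tau> by (rule \<tau>)
  have mem: "c \<in> T" "of_int \<nu> \<in> T"
    using c Rats_subset_subfield[OF \<tau>.subfield] subfield_of_int[OF \<tau>.subfield] by auto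
  have "(\<tau> w)\<^sup>2 = \<tau> (c * (of_int \<nu> + x (Suc i)))" using w \<tau>.hom_square by metis
  also have "\<dots> = c * (of_int \<nu> - x (Suc i))"
    using mem x c by (simp add: \<tau>.hom_mult \<tau>.hom_add \<tau>.hom_Rats subfield_add[OF \<tau>.subfield])
  finally have "(w * \<tau> w)\<^sup>2 = c\<^sup>2 * ((of_int \<nu>)\<^sup>2 - (x (Suc i))\<^sup>2)"
    by (simp add: power_mult_distrib w(2)) (simp add: algebra_simps power2_eq_square)
  thus ?thesis by (simp add: x_Suc)
qed

end

subsection \<open>Proper towers\<close>

locale proper_sqrt_tower = sqrt_tower +
  assumes x_Suc_notin: "x (Suc n) \<notin> K n"
begin

lemmas sqrt_extension_Suc = sqrt_extension_K[OF x_Suc_notin]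

lemma quadext_K: "quadext (K n) (K (Suc n))"
  unfolding K_Suc by (rule quadext_adjoin[OF sqrt_extension_Suc])

lemma x_Suc_nonzero: "x (Suc n) \<noteq> 0"
  using x_Suc_notin[of n] subfield_zero[OF subfield_K, of n] by metis

lemma K_psubset: "m < n \<Longrightarrow> K m \<subset> K n"
  by (rule lift_Suc_mono_less[of K, OF quadext_psubset[OF quadext_K]])

lemma has_degree_K: "has_degree (K n) \<rat> (2 ^ n)"
proof (induction n)
  case 0
  show ?case using has_degree_self[OF subfield_Rats] by (simp add: K_0)
next
  case (Suc n)
  thus ?case using has_degree_quadext[OF subfield_Rats Suc.IH quadext_K] by simp
qed

lemma square_mem_K_descends:
  assumes nonsquare: "\<And>c. c \<in> K k \<Longrightarrow> c\<^sup>2 \<noteq> of_int (u \<nu> 0) - x k"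
    and b: "b \<in> K (Suc (Suc k))" "b\<^sup>2 \<in> K k"
  shows "b \<in> K (Suc k)"
proof (rule ccontr)
  let ?y = "x (Suc (Suc k))"
  assume notin: "b \<notin> K (Suc k)"
  have "b\<^sup>2 \<in> K (Suc k)" using b(2) K_mono[of k "Suc k"] by auto
  hence "b * ?y \<in> K (Suc k)"
    using b(1) notin K_Suc by (intro sqrt_extension.sqrt_mult_mem[OF sqrt_extension_Suc]) auto
  moreover have "(b * ?y)\<^sup>2 = b\<^sup>2 * of_int \<nu> + b\<^sup>2 * x (Suc k)"
    by (simp add: power_mult_distrib x_Suc distrib_left)
  ultimately obtain d where d: "d \<in> K k" "d\<^sup>2 = (b\<^sup>2 * of_int \<nu>)\<^sup>2 - (b\<^sup>2)\<^sup>2 * (x (Suc k))\<^sup>2"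
    unfolding K_Suc
    by (rule sqrt_extension.square_norm_trace[OF sqrt_extension_Suc])
       (simp_all add: b(2) subfield_closed subfield_K)
  have "b \<noteq> 0" using notin subfield_zero[OF subfield_K] by auto
  hence "(d / b\<^sup>2)\<^sup>2 = (of_int \<nu>)\<^sup>2 - (x (Suc k))\<^sup>2"
    by (simp add: power_divide d(2) power_mult_distrib field_simps)
  hence "(d / b\<^sup>2)\<^sup>2 = of_int (u \<nu> 0) - x k" by (simp add: x_Suc)
  moreover have "d / b\<^sup>2 \<in> K k" using d(1) b(2) by (intro subfield_divide subfield_K)
  ultimately show False using nonsquare by blast
qed

lemma square_mem_K_descends_to:
  assumes nonsquare: "\<And>k c. k \<ge> j \<Longrightarrow> c \<in> K k \<Longrightarrow> c\<^sup>2 \<noteq> of_int (u \<nu> 0) - x k"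
    and b: "b \<in> K n" "b\<^sup>2 \<in> K j"
  shows "b \<in> K (Suc j)"
proof (cases "n \<le> Suc j")
  case True
  thus ?thesis using b(1) K_mono by blast
next
  case False
  hence "Suc j \<le> n" by simp
  thus ?thesis
  proof (induction rule: inc_induct)
    case (step m)
    then obtain k where k: "m = Suc k" "j \<le> k" by (cases m) auto
    hence "b\<^sup>2 \<in> K k" using b(2) K_mono by blast
    moreover have "b \<in> K (Suc (Suc k))" using step.IH k(1) by simp
    ultimately show ?case
      using square_mem_K_descends[OF nonsquare[OF k(2)]] k(1) by simp
  qed (rule b(1))
qed

text \<open>The product of \<open>x\<^sub>i\<^sub>+\<^sub>2\<close> and its conjugate is a square root of \<open>u\<^sub>0 - x\<^sub>i\<close> fixed by \<open>\<tau>\<close>.\<close>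

lemma involution_moved_generator:
  assumes \<tau>: "field_involution (K n) \<tau>" and n: "Suc i < n"
    and x: "\<tau> (x i) = x i" "\<tau> (x (Suc i)) = - x (Suc i)"
  shows "\<exists>k\<ge>i. \<exists>a::int. u \<nu> k - x0 = a\<^sup>2"
proof (rule ccontr)
  assume none: "\<not> ?thesis"
  let ?F = "fixed_field (K n) \<tau>"
  interpret \<tau>: field_involution "K n" \<tau> by (rule \<tau>)
  define b where "b = x (Suc (Suc i)) * \<tau> (x (Suc (Suc i)))"
  have mem: "x i \<in> K n" "x (Suc i) \<in> K n" "x (Suc (Suc i)) \<in> K n"
    using n by (intro x_mem_K_le; simp)+
  have b_fixed: "b \<in> ?F" unfolding b_def by (rule \<tau>.mult_conj_fixed[OF mem(3)])
  have b_square: "b\<^sup>2 = of_int (u \<nu> 0) - x i"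
    using conj_product_square[OF \<tau> mem(3), of 1 i] x mem by (simp add: x_Suc b_def)
  have nonsquare: "c\<^sup>2 \<noteq> of_int (u \<nu> 0) - x k" if "k \<ge> i" "c \<in> K k" for k c
    using u_minus_x_square_imp[OF x_Suc_notin that(2), of 0] none that(1) by auto
  have "b\<^sup>2 \<in> K i" unfolding b_square by (intro subfield_closed subfield_K x_mem_K)
  hence "b \<in> K (Suc i)"
    using b_fixed
    by (intro square_mem_K_descends_to[where n = n] nonsquare) (auto simp: fixed_field_def)
  moreover have "x i \<in> ?F" "x (Suc i) \<notin> ?F"
    using mem x x_Suc_nonzero[of i] by (auto simp: fixed_field_def)
  ultimately have "b \<in> K i" using Int_K_Suc[OF \<tau>.subfield_fixed_field] b_fixed by blast
  thus False using nonsquare[of i b] b_square by simp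
qed

lemma index_two_closed_K:
  assumes quadratic: "\<And>W. W \<in> \<W> \<Longrightarrow> quadext \<rat> W"
    and index_two: "\<And>n E. quadext E (K (Suc n)) \<Longrightarrow> E = K n \<or> E \<in> \<W>"
  shows "index_two_closed (range K \<union> \<W>)"
  unfolding index_two_closed_def
proof (intro ballI conjI allI impI)
  fix T assume T: "T \<in> range K \<union> \<W>"
  thus "quadratic_tower T"
    using quadratic_tower_K quadratic_tower_quadext[OF quadratic_tower.Rats] quadratic by blast
  fix E assume E: "quadext E T"
  hence Rats_E: "\<rat> \<subseteq> E" "E \<subset> T" using quadext_subfield(1) Rats_subset_subfield quadext_psubset
    by blast+
  show "E \<in> range K \<union> \<W>"
  proof (cases "T \<in> \<W>")
    case True
    hence "E = \<rat>" using quadext_base_unique[OF quadratic E] Rats_E(1) by blast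
    thus ?thesis using K_0 by (metis UnI1 rangeI)
  next
    case False
    then obtain n where "T = K n" using T by blast
    moreover from this have "n \<noteq> 0" using Rats_E K_0 by auto
    ultimately show ?thesis using E index_two by (cases n) auto
  qed
qed

lemma proper_subfields_of_Union:
  assumes W: "\<And>W. W \<in> \<W> \<Longrightarrow> quadext \<rat> W" "\<And>W. W \<in> \<W> \<Longrightarrow> W \<subseteq> K 2"
    and index_two: "\<And>n E. quadext E (K (Suc n)) \<Longrightarrow> E = K n \<or> E \<in> \<W>"
  shows "proper_subfields_of (\<Union>n. K n) = range K \<union> \<W>"
proof (intro equalityI subsetI)
  fix F assume "F \<in> proper_subfields_of (\<Union>n. K n)"
  hence F: "subfield F CC" "F \<subset> (\<Union>n. K n)" by (auto simp: proper_subfields_of_def)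
  have "G \<subseteq> K (Suc n) \<or> K n \<subseteq> G" if G: "G \<in> range K \<union> \<W>" for G n
  proof (cases "G \<in> \<W>")
    case True
    hence "G \<subseteq> K 2" "K 0 \<subseteq> G" using W quadext_psubset K_0 by blast+
    thus ?thesis using K_mono[of 2 "Suc n"] by (cases n) auto
  next
    case False
    then obtain j where "G = K j" using G by blast
    thus ?thesis using K_mono[of j n] K_mono[of n "Suc n"] K_mono[of n j] by (cases "j \<le> n") auto
  qed
  hence "F \<in> range K \<union> \<W> \<or> (\<Union>n. K n) \<subseteq> F"
    using F by (intro index_two_closed_Union[OF index_two_closed_K[OF W(1) index_two], of K]) auto
  thus "F \<in> range K \<union> \<W>" using F(2) by (meson leD)
next
  fix F assume "F \<in> range K \<union> \<W>"
  then obtain n where "F \<subseteq> K n" "subfield F CC"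
    using subfield_K W quadext_subfield(2) by blast
  thus "F \<in> proper_subfields_of (\<Union>n. K n)"
    unfolding proper_subfields_of_def using K_psubset[of n "Suc n"] by blast
qed

end

subsection \<open>Towers in which \<open>u\<^sub>j - x\<^sub>0\<close> is not a square for \<open>j \<ge> 1\<close>\<close>

locale rigid_sqrt_tower = proper_sqrt_tower +
  assumes u_minus_x0_nonsquare: "j \<ge> 1 \<Longrightarrow> u \<nu> j - x0 \<noteq> (a::int)\<^sup>2"
begin

lemma u_minus_x_nonsquare:
  assumes "k \<ge> 1" "c \<in> K k"
  shows "c\<^sup>2 \<noteq> of_int (u \<nu> 0) - x k"
  using u_minus_x_square_imp[OF x_Suc_notin assms(2), of 0] u_minus_x0_nonsquare[OF assms(1)]
  by auto

lemma involution_cases: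
  assumes \<tau>: "field_involution (K n) \<tau>" and moved: "fixed_field (K n) \<tau> \<noteq> K n"
  obtains (predecessor) m where "n = Suc m" "fixed_field (K n) \<tau> = K m"
  | (exceptional) a :: int where "u \<nu> 0 - x0 = a\<^sup>2" "n \<ge> 2" "\<tau> (x 1) = - x 1"
proof -
  let ?F = "fixed_field (K n) \<tau>"
  interpret \<tau>: field_involution "K n" \<tau> by (rule \<tau>)
  have fixed_psubset: "?F \<subset> K n" using moved by (auto simp: fixed_field_def)
  hence "x n \<notin> ?F" using K_subset_iff[OF \<tau>.subfield_fixed_field] by blast
  moreover have "x 0 \<in> ?F" unfolding x_0 by (rule subfield_of_int[OF \<tau>.subfield_fixed_field])
  ultimately obtain i where i: "i < n" "x i \<in> ?F" "x (Suc i) \<notin> ?F"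
    using ex_least_nat_less[of "\<lambda>k. x k \<notin> ?F" n] by blast
  show ?thesis
  proof (cases "n = Suc i")
    case True
    thus ?thesis using predecessor Int_K_Suc[OF \<tau>.subfield_fixed_field i(2,3)] fixed_psubset
      by (simp add: Int_absorb2)
  next
    case False
    hence n: "Suc i < n" using i(1) by simp
    have "(x (Suc i))\<^sup>2 \<in> ?F"
      using i(2) by (simp add: x_Suc subfield_add subfield_of_int \<tau>.subfield_fixed_field)
    moreover have mem: "x (Suc i) \<in> K n" using i(1) by (intro x_mem_K_le) simp
    ultimately have \<tau>_x: "\<tau> (x (Suc i)) = - x (Suc i)"
      using \<tau>.hom_sqrt_cases[of "x (Suc i)"] i(3) by (auto simp: fixed_field_def)
    then obtain k a where k: "k \<ge> i" "u \<nu> k - x0 = a\<^sup>2"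
      using involution_moved_generator[OF \<tau> n] i(2) by (auto simp: fixed_field_def)
    hence "k = 0" using u_minus_x0_nonsquare[of k a] by (cases k) auto
    thus ?thesis using exceptional k \<tau>_x n by auto
  qed
qed

lemma index_two_cases:
  assumes "quadext E (K (Suc n))"
  obtains (predecessor) "E = K n"
  | (exceptional) \<tau> and a :: int where
      "field_involution (K (Suc n)) \<tau>" "fixed_field (K (Suc n)) \<tau> = E"
      "u \<nu> 0 - x0 = a\<^sup>2" "n \<ge> 1" "\<tau> (x 1) = - x 1"
proof -
  obtain \<tau> where \<tau>: "field_involution (K (Suc n)) \<tau>" "fixed_field (K (Suc n)) \<tau> = E"
    using assms by (rule quadext_involution)
  moreover have "E \<noteq> K (Suc n)" using quadext_psubset[OF assms] by blast
  ultimately show ?thesis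
    by (cases rule: involution_cases[OF \<tau>(1)]) (use predecessor exceptional \<tau> in auto)
qed

lemma proper_subfields_of_Union_nonsquare:
  assumes "\<nexists>a::int. u \<nu> 0 - x0 = a\<^sup>2"
  shows "proper_subfields_of (\<Union>n. K n) = range K"
proof -
  have "E = K n" if "quadext E (K (Suc n))" for n E
    using that by (cases rule: index_two_cases) (use assms in blast)+
  thus ?thesis using proper_subfields_of_Union[of "{}"] by simp
qed

end

subsection \<open>The two additional quadratic fields\<close>

locale square_sqrt_tower = rigid_sqrt_tower +
  fixes a :: int
  assumes a_square: "u \<nu> 0 - x0 = a\<^sup>2"
begin

definition w :: "int \<Rightarrow> complex" where "w b = x 2 + of_int b / x 2"

definition W :: "int \<Rightarrow> complex set" where "W b = adjoin \<rat> {w b}"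

lemma x_1_square: "(x 1)\<^sup>2 = of_int (\<nu> + x0)"
  and x_2_square: "(x 2)\<^sup>2 = of_int \<nu> + x 1"
  and x_3_square: "(x 3)\<^sup>2 = of_int \<nu> + x 2"
  using x_Suc[of 0] x_Suc[of 1] x_Suc[of 2] by (simp_all add: x_0 eval_nat_numeral)

lemma x_2_notin: "x 2 \<notin> K 1" and sqrt_extension_x_3: "sqrt_extension (K 2) (x 3)"
  and K_3: "K 3 = adjoin (K 2) {x 3}"
  using x_Suc_notin[of 1] sqrt_extension_Suc[of 2] K_Suc[of 2] by (simp_all add: eval_nat_numeral)

lemma x_nonzero: "n > 0 \<Longrightarrow> x n \<noteq> 0"
  using x_Suc_nonzero by (cases n) auto

context
  fixes b :: int
  assumes b: "b\<^sup>2 = a\<^sup>2"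
begin

lemma b_square_div: "(of_int b)\<^sup>2 / (x 2)\<^sup>2 = of_int \<nu> - x 1"
proof -
  have "b\<^sup>2 = \<nu>\<^sup>2 - (\<nu> + x0)" using a_square b by simp
  hence "(of_int b)\<^sup>2 = (of_int \<nu>)\<^sup>2 - (x 1)\<^sup>2"
    unfolding x_1_square by (metis of_int_diff of_int_power)
  also have "\<dots> = (of_int \<nu> - x 1) * (x 2)\<^sup>2"
    unfolding x_2_square by (simp add: algebra_simps power2_eq_square)
  finally show ?thesis using x_nonzero[of 2] by simp
qed

lemma w_square: "(w b)\<^sup>2 = of_int (2 * (\<nu> + b))"
proof -
  have "(w b)\<^sup>2 = (x 2)\<^sup>2 + 2 * of_int b + (of_int \<nu> - x 1)"
    unfolding b_square_div[symmetric] using x_nonzero[of 2]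
    by (simp add: w_def power2_sum power_divide)
  thus ?thesis unfolding x_2_square by simp
qed

lemma w_mult: "w b * w (- b) = 2 * x 1"
proof -
  have "w b * w (- b) = (x 2)\<^sup>2 - (of_int \<nu> - x 1)"
    unfolding b_square_div[symmetric] by (simp add: w_def algebra_simps power2_eq_square)
  thus ?thesis unfolding x_2_square by simp
qed

lemma w_add: "w b + w (- b) = 2 * x 2"
  by (simp add: w_def)

lemma w_notin_K_1: "w b \<notin> K 1"
proof
  assume w: "w b \<in> K 1"
  have "w b \<noteq> 0" using w_mult x_nonzero[of 1] by auto
  hence "w (- b) = 2 * x 1 / w b" using w_mult by (simp add: field_simps)
  hence "w (- b) \<in> K 1" using w x_mem_K[of 1] by (auto intro!: subfield_closed subfield_K)
  hence "(w b + w (- b)) / 2 \<in> K 1" using w by (intro subfield_closed subfield_K)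
  thus False using x_2_notin by (simp add: w_add)
qed

lemma sqrt_extension_w: "sqrt_extension \<rat> (w b)"
proof (intro sqrt_extension.intro subfield_Rats)
  show "(w b)\<^sup>2 \<in> \<rat>" by (simp add: w_square)
  show "w b \<notin> \<rat>" using w_notin_K_1 K_mono[of 0 1] by (auto simp: K_0)
qed

lemma quadext_W: "quadext \<rat> (W b)"
  unfolding W_def by (rule quadext_adjoin[OF sqrt_extension_w])

lemma adjoin_w_mult: "adjoin \<rat> {w b * w (- b)} = K 1"
proof -
  have "2 * x 1 / 2 \<in> adjoin \<rat> {2 * x 1}"
    by (rule subfield_divide[OF subfield_adjoin mem_adjoin subfield_numeral[OF subfield_adjoin]])
  moreover have "2 * x 1 \<in> adjoin \<rat> {x 1}"
    by (intro subfield_closed subfield_adjoin mem_adjoin)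
  ultimately show ?thesis unfolding w_mult tower_field_def by (intro adjoin_eqI) simp_all
qed

lemma adjoin_w_w: "adjoin \<rat> {w b, w (- b)} = K 2"
proof -
  have "w b \<in> adjoin \<rat> {w b, w (- b)}" "w (- b) \<in> adjoin \<rat> {w b, w (- b)}"
    using subset_adjoin(2) by blast+
  hence "(w b + w (- b)) / 2 \<in> adjoin \<rat> {w b, w (- b)}" by (intro subfield_closed subfield_adjoin)
  moreover have "w b \<in> K 2" "w (- b) \<in> K 2"
    unfolding w_def by (intro subfield_closed subfield_K x_mem_K)+
  ultimately show ?thesis unfolding tower_field_def by (intro adjoin_eqI) (simp_all add: w_add)
qed

lemma W_eq_sqrtC: "W b = adjoin \<rat> {sqrtC (2 * (\<nu> + b))}"
  unfolding W_def by (rule adjoin_eq_if_square_eq) (simp only: w_square sqrtC_def power2_csqrt)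

end

context
  fixes b :: int
  assumes b: "b\<^sup>2 = a\<^sup>2"
begin

lemma biquadratic_w: "biquadratic_extension \<rat> (w b) (w (- b))"
proof (intro biquadratic_extension.intro sqrt_extension_w)
  have "K 1 \<noteq> \<rat>" using K_psubset[of 0 1] K_0 by auto
  thus "w b * w (- b) \<notin> \<rat>"
    using adjoin_absorb[OF subfield_Rats] adjoin_w_mult[OF b] by fastforce
qed (use b in simp_all)

lemma quadext_W_K_2: "quadext (W b) (K 2)"
  using biquadratic_extension.quadext_fst[OF biquadratic_w] by (simp add: W_def adjoin_w_w b)

lemma W_subset_K_2: "W b \<subseteq> K 2"
  using quadext_psubset[OF quadext_W_K_2] by blast

lemma distinct_W: "W b \<noteq> W (- b)" "W b \<noteq> K 1"
  using biquadratic_extension.distinct_adjoin[OF biquadratic_w] unfolding adjoin_w_mult[OF b] W_def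
  by auto

lemma W_notin_range: "W b \<notin> range K"
proof
  assume "W b \<in> range K"
  then obtain n where n: "W b = K n" by blast
  consider "n = 0" | "n = 1" | "n \<ge> 2" by linarith
  thus False
  proof cases
    assume "n = 0"
    thus False using n K_0 quadext_psubset[OF quadext_W[OF b]] by simp
  next
    assume "n \<ge> 2"
    thus False using n K_mono[of 2 n] quadext_psubset[OF quadext_W_K_2] by blast
  qed (use n distinct_W in simp)
qed

lemma index_two_K_2:
  assumes "quadext E (K 2)"
  shows "E \<in> {W b, W (- b), K 1}"
proof -
  have "\<rat> \<subseteq> E" using Rats_subset_subfield quadext_subfield(1)[OF assms] by blast
  thus ?thesis
    using biquadratic_extension.index_two_iff[OF biquadratic_w] assms
    unfolding adjoin_w_mult[OF b] adjoin_w_w[OF b] W_def by simp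
qed

text \<open>The norm of \<open>\<nu>\<^sup>2 + b + \<nu> w\<^sub>b\<close> to the rationals.\<close>

lemma norm_eq_u_minus_x0: "(\<nu>\<^sup>2 + b)\<^sup>2 - \<nu>\<^sup>2 * (2 * (\<nu> + b)) = u \<nu> 1 - x0"
proof -
  have "(\<nu>\<^sup>2 + b)\<^sup>2 - \<nu>\<^sup>2 * (2 * (\<nu> + b)) = \<nu> ^ 4 - 2 * \<nu> ^ 3 + b\<^sup>2"
    by (simp add: algebra_simps power2_eq_square power3_eq_cube power4_eq_xxxx)
  also have "\<dots> = \<nu> ^ 4 - 2 * \<nu> ^ 3 + (\<nu>\<^sup>2 - \<nu> - x0)" using a_square b by simp
  also have "\<dots> = u \<nu> 1 - x0"
    by (simp add: power2_eq_square power3_eq_cube power4_eq_xxxx algebra_simps)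
  finally show ?thesis .
qed

lemma nonsquare_W:
  assumes "d \<in> W b"
  shows "d\<^sup>2 \<noteq> of_int (\<nu>\<^sup>2 + b) + of_int \<nu> * w b"
proof
  assume d_square: "d\<^sup>2 = of_int (\<nu>\<^sup>2 + b) + of_int \<nu> * w b"
  obtain e where e: "e \<in> \<rat>" "e\<^sup>2 = (of_int (\<nu>\<^sup>2 + b))\<^sup>2 - (of_int \<nu>)\<^sup>2 * (w b)\<^sup>2"
    by (rule sqrt_extension.square_norm_trace[OF sqrt_extension_w[OF b] _ d_square])
       (use assms in \<open>simp_all only: W_def Rats_of_int\<close>)
  have "e\<^sup>2 = of_int ((\<nu>\<^sup>2 + b)\<^sup>2 - \<nu>\<^sup>2 * (2 * (\<nu> + b)))" unfolding e(2) w_square[OF b] by simp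
  hence "e\<^sup>2 = of_int (u \<nu> 1 - x0)" unfolding norm_eq_u_minus_x0 .
  with e(1) obtain c where "u \<nu> 1 - x0 = c\<^sup>2" by (rule Rats_sqrt_of_intE)
  thus False using u_minus_x0_nonsquare[of 1] by blast
qed

end

lemma conj_product_x_2:
  assumes "field_involution T \<tau>" "x 1 \<in> T" "x 2 \<in> T" "\<tau> (x 1) = - x 1"
  obtains b :: int where "b\<^sup>2 = a\<^sup>2" "\<tau> (x 2) = of_int b / x 2"
proof -
  have "(x 2 * \<tau> (x 2))\<^sup>2 = of_int (u \<nu> 0 - x0)"
    using conj_product_square[OF assms(1,3), of 1 0] assms x_0 x_2_square by simp
  also have "\<dots> = (of_int a)\<^sup>2" unfolding a_square by simp
  finally have "x 2 * \<tau> (x 2) = of_int a \<or> x 2 * \<tau> (x 2) = of_int (- a)"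
    by (simp add: power2_eq_iff)
  thus ?thesis using that[of a] that[of "- a"] x_nonzero[of 2] by (auto simp: field_simps)
qed

lemma conj_product_x_3_square:
  assumes "field_involution T \<tau>" "x 2 \<in> T" "x 3 \<in> T" "\<tau> (x 2) = of_int b / x 2"
  shows "(x 3 * \<tau> (x 3))\<^sup>2 = of_int (\<nu>\<^sup>2 + b) + of_int \<nu> * w b"
proof -
  interpret \<tau>: field_involution T \<tau> by (rule assms(1))
  have "(\<tau> (x 3))\<^sup>2 = \<tau> (of_int \<nu> + x 2)"
    using \<tau>.hom_square[OF assms(3)] x_3_square by simp
  also have "\<dots> = of_int \<nu> + of_int b / x 2"
    using assms by (simp add: \<tau>.hom_add \<tau>.hom_Rats subfield_of_int[OF \<tau>.subfield])
  finally have "(x 3 * \<tau> (x 3))\<^sup>2 = (of_int \<nu> + x 2) * (of_int \<nu> + of_int b / x 2)"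
    by (simp add: power_mult_distrib x_3_square)
  also have "\<dots> = (of_int \<nu>)\<^sup>2 + x 2 * (of_int b / x 2) + of_int \<nu> * w b"
    by (simp only: w_def ring_distribs power2_eq_square ac_simps)
  finally show ?thesis using x_nonzero[of 2] by simp
qed

lemma fixed_field_Int_K_2:
  assumes \<tau>: "field_involution T \<tau>" and mem: "x 1 \<in> T" "x 2 \<in> T" and b: "b\<^sup>2 = a\<^sup>2"
    and \<tau>_x: "\<tau> (x 1) = - x 1" "\<tau> (x 2) = of_int b / x 2"
  shows "fixed_field T \<tau> \<inter> K 2 = W b"
proof -
  let ?F = "fixed_field T \<tau>"
  interpret \<tau>: field_involution T \<tau> by (rule \<tau>)
  have F: "subfield ?F CC" by (rule \<tau>.subfield_fixed_field)
  have "w b \<in> ?F" using \<tau>.add_conj_fixed[OF mem(2)] by (simp add: w_def \<tau>_x(2))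
  hence "W b \<subseteq> ?F" unfolding W_def by (simp add: adjoin_Rats_subset_iff F)
  moreover have "x 1 \<notin> ?F" "x 1 \<in> K 2"
    using \<tau>_x(1) x_nonzero[of 1] by (auto simp: fixed_field_def intro: x_mem_K_le)
  ultimately show ?thesis
    using quadext_intermediate_cases[OF quadext_W_K_2[OF b] subfield_Int[OF F subfield_K]]
      W_subset_K_2[OF b] by blast
qed

lemma involution_mem_K_2:
  assumes \<tau>: "field_involution T \<tau>" and x_2: "x 2 \<in> T" "\<tau> (x 2) \<in> K 2" and c: "c \<in> K 2"
  shows "\<tau> c \<in> K 2"
proof -
  interpret \<tau>: field_involution T \<tau> by (rule \<tau>)
  have "K 2 \<subseteq> {c \<in> T. \<tau> c \<in> K 2}"
    using x_2 by (simp add: K_subset_iff \<tau>.subfield_vimage[OF subfield_K])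
  thus ?thesis using c by blast
qed

lemma involution_moving_x_1:
  assumes \<tau>: "field_involution (K n) \<tau>" and \<tau>_x_1: "\<tau> (x 1) = - x 1"
  shows "n \<le> 2"
proof (rule ccontr)
  assume "\<not> n \<le> 2"
  hence mem: "x 1 \<in> K n" "x 2 \<in> K n" "x 3 \<in> K n" by (auto intro!: x_mem_K_le)
  interpret \<tau>: field_involution "K n" \<tau> by (rule \<tau>)
  obtain b where b: "b\<^sup>2 = a\<^sup>2" and \<tau>_x_2: "\<tau> (x 2) = of_int b / x 2"
    using conj_product_x_2[OF \<tau> mem(1,2) \<tau>_x_1] .
  define d where "d = x 3 * \<tau> (x 3)"
  have d_fixed: "d \<in> fixed_field (K n) \<tau>" unfolding d_def by (rule \<tau>.mult_conj_fixed[OF mem(3)])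
  have d_square: "d\<^sup>2 = of_int (\<nu>\<^sup>2 + b) + of_int \<nu> * w b"
    unfolding d_def by (rule conj_product_x_3_square[OF \<tau> mem(2,3) \<tau>_x_2])
  have d_square_mem: "d\<^sup>2 \<in> K 2"
    unfolding d_square w_def by (intro subfield_closed subfield_K x_mem_K)
  hence d_K_3: "d \<in> adjoin (K 2) {x 3}"
    using square_mem_K_descends_to[of 2 d n] u_minus_x_nonsquare d_fixed K_3
    by (auto simp: fixed_field_def numeral_3_eq_3)
  have "d \<in> K 2"
  proof (rule ccontr)
    assume "d \<notin> K 2"
    hence "d * x 3 \<in> K 2"
      by (rule sqrt_extension.sqrt_mult_mem[OF sqrt_extension_x_3 d_K_3 d_square_mem])
    hence "d * x 3 / (x 3)\<^sup>2 \<in> K 2"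
      by (rule subfield_divide[OF subfield_K _ sqrt_extension.square_mem[OF sqrt_extension_x_3]])
    hence "\<tau> (x 3) \<in> K 2" using x_nonzero[of 3] by (simp add: d_def power2_eq_square)
    moreover have "\<tau> (x 2) \<in> K 2" unfolding \<tau>_x_2 by (intro subfield_closed subfield_K x_mem_K)
    ultimately have "\<tau> (\<tau> (x 3)) \<in> K 2" using involution_mem_K_2[OF \<tau> mem(2)] by blast
    thus False using \<tau>.involutive[OF mem(3)] sqrt_extension.notin[OF sqrt_extension_x_3] by simp
  qed
  hence "d \<in> W b" using d_fixed fixed_field_Int_K_2[OF \<tau> mem(1,2) b \<tau>_x_1 \<tau>_x_2] by blast
  thus False using nonsquare_W[OF b] d_square by blast
qed

lemma index_two_eq_K_or_W:
  assumes E: "quadext E (K (Suc n))"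
  shows "E = K n \<or> E \<in> {W (- a), W a}"
  using E
proof (cases rule: index_two_cases)
  case (exceptional \<tau> c)
  hence "n = 1" using involution_moving_x_1[OF exceptional(1,5)] by simp
  thus ?thesis using index_two_K_2[of a E] E by (auto simp: numeral_2_eq_2)
qed simp

lemma proper_subfields_of_Union_square:
  "proper_subfields_of (\<Union>n. K n) = range K \<union> {W (- a), W a}"
proof (rule proper_subfields_of_Union)
  fix V assume "V \<in> {W (- a), W a}"
  then obtain b where b: "V = W b" "b\<^sup>2 = a\<^sup>2" by auto
  show "quadext \<rat> V" unfolding b(1) by (rule quadext_W[OF b(2)])
  show "V \<subseteq> K 2" unfolding b(1) by (rule W_subset_K_2[OF b(2)])
qed (rule index_two_eq_K_or_W)

end

section \<open>The set \<open>\<Omega>\<close>\<close>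

lemma sqrt_tower_xseq: "sqrt_tower \<nu> x0 (xseq \<nu> x0 s)"
  by unfold_locales (simp, simp)

lemma Kn_eq_tower_field: "Kn \<nu> x0 s = tower_field (xseq \<nu> x0 s)"
  by (simp add: fun_eq_iff Kn_def tower_field_def)

lemma Kinf_eq_Union_tower_field: "Kinf \<nu> x0 s = (\<Union>n. tower_field (xseq \<nu> x0 s) n)"
  by (simp add: Kinf_def Kn_eq_tower_field)

text \<open>The interval \<open>[- \<nu>, \<nu>\<^sup>2 - \<nu>]\<close> is mapped into \<open>[- \<nu>, \<nu>]\<close> by \<open>t \<mapsto> \<plusminus> \<surd>(\<nu> + t)\<close>.\<close>

lemma (in sqrt_tower) x_real_bounded:
  assumes "\<nu> \<ge> 2" "x0 \<ge> 0" "x0 \<le> \<nu>\<^sup>2 - \<nu>"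
  shows "\<exists>r. x n = of_real r \<and> - of_int \<nu> \<le> r \<and> r \<le> of_int (\<nu>\<^sup>2 - \<nu>)"
proof (induction n)
  case 0
  have "- of_int \<nu> \<le> (of_int x0 :: real)" "(of_int x0 :: real) \<le> of_int (\<nu>\<^sup>2 - \<nu>)"
    using assms by (simp_all only: of_int_le_iff flip: of_int_minus)
  thus ?case by (intro exI[of _ "of_int x0"]) (simp add: x_0)
next
  case (Suc n)
  then obtain r where r: "x n = of_real r" "- of_int \<nu> \<le> r" "r \<le> of_int (\<nu>\<^sup>2 - \<nu>)" by blast
  define t where "t = sqrt (of_int \<nu> + r)"
  have "(x (Suc n))\<^sup>2 = (of_real t)\<^sup>2" using r(1,2) by (simp add: x_Suc t_def flip: of_real_power)
  hence "x (Suc n) = of_real t \<or> x (Suc n) = of_real (- t)" by (simp add: power2_eq_iff)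
  moreover have "of_int \<nu> + r \<le> (of_int \<nu>)\<^sup>2" using r(3) by simp
  hence "0 \<le> t" "t \<le> of_int \<nu>" using assms(1) r(2) by (simp_all add: t_def real_le_lsqrt)
  moreover have "\<nu>\<^sup>2 \<ge> 2 * \<nu>" using assms(1) by (simp add: power2_eq_square)
  hence "of_int \<nu> \<le> (of_int (\<nu>\<^sup>2 - \<nu>) :: real)" by (simp only: of_int_le_iff)
  ultimately show ?case
    by (elim disjE) (rule exI, rule conjI, assumption, linarith)+
qed

lemma (in sqrt_tower) sqrt_tower_embedding:
  assumes "subfield_embedding F \<sigma>" "\<And>n. x n \<in> F"
  shows "sqrt_tower \<nu> x0 (\<lambda>n. \<sigma> (x n))"
proof -
  interpret \<sigma>: subfield_embedding F \<sigma> by fact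
  have "(\<sigma> (x (Suc n)))\<^sup>2 = of_int \<nu> + \<sigma> (x n)" for n
    using assms(2) subfield_of_int[OF \<sigma>.subfield]
    by (simp add: x_Suc \<sigma>.hom_add \<sigma>.hom_Rats flip: \<sigma>.hom_square)
  thus ?thesis by (intro sqrt_tower.intro) (simp_all add: x_0 \<sigma>.hom_Rats)
qed

lemma (in sqrt_tower) totally_real_Union_K:
  assumes "\<nu> \<ge> 2" "x0 \<ge> 0" "x0 \<le> \<nu>\<^sup>2 - \<nu>"
  shows "totally_real (\<Union>n. K n)"
  unfolding totally_real_def
proof
  let ?K = "\<Union>n. K n"
  fix \<sigma> assume "\<sigma> \<in> ring_hom (CC\<lparr>carrier := ?K\<rparr>) CC"
  then interpret \<sigma>: subfield_embedding ?K \<sigma>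
    by (intro subfield_embedding.intro subfield_Union_K)
  have x: "x n \<in> ?K" for n using x_mem_K by blast
  have "\<sigma> (x n) \<in> \<real>" for n
    using sqrt_tower.x_real_bounded[OF sqrt_tower_embedding[OF \<sigma>.subfield_embedding_axioms x] assms]
    by (metis Reals_of_real)
  moreover have "subfield {c \<in> ?K. \<sigma> c \<in> \<real>} CC"
    by (intro \<sigma>.subfield_vimage subfield_CC_I) auto
  ultimately have "K n \<subseteq> {c \<in> ?K. \<sigma> c \<in> \<real>}" for n
    using x by (simp add: K_subset_iff)
  thus "\<sigma> ` ?K \<subseteq> \<real>" by blast
qed

text \<open>With the sign choice \<open>x\<^sub>1 = - \<surd>(\<nu> + x\<^sub>0)\<close>, reality of \<open>x\<^sub>2\<close> forces \<open>\<surd>(\<nu> + x\<^sub>0) \<le> \<nu>\<close>.\<close>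

lemma Omega_bounds:
  assumes "(\<nu>, x0) \<in> Omega"
  shows "\<nu> \<ge> 2" "x0 \<ge> 0" "x0 \<le> \<nu>\<^sup>2 - \<nu>"
proof -
  show nu: "\<nu> \<ge> 2" "x0 \<ge> 0" using assms by (auto simp: Omega_def)
  define s where "s n = (n \<noteq> 0)" for n :: nat
  have "totally_real (Kinf \<nu> x0 s)" using assms by (auto simp: Omega_def)
  moreover have "(\<lambda>z. z) \<in> ring_hom (CC\<lparr>carrier := Kinf \<nu> x0 s\<rparr>) CC"
    by (auto simp: ring_hom_def)
  ultimately have "Kinf \<nu> x0 s \<subseteq> \<real>" unfolding totally_real_def by force
  moreover have "xseq \<nu> x0 s 2 \<in> Kinf \<nu> x0 s"
    unfolding Kinf_eq_Union_tower_field using mem_tower_field by blast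
  ultimately obtain r where r: "xseq \<nu> x0 s 2 = of_real r" by (auto elim: Reals_cases)
  have "(xseq \<nu> x0 s 2)\<^sup>2 = of_int \<nu> + xseq \<nu> x0 s 1"
    using sqrt_tower.x_Suc[OF sqrt_tower_xseq, of \<nu> x0 s 1] by (simp only: Suc_1)
  also have "xseq \<nu> x0 s 1 = - csqrt (of_real (of_int (\<nu> + x0)))" by (simp add: s_def)
  also have "csqrt (of_real (of_int (\<nu> + x0))) = of_real (sqrt (of_int (\<nu> + x0)))"
    using nu by (simp add: csqrt_of_real_nonneg del: of_int_add)
  finally have "of_real (r\<^sup>2) = (of_real (of_int \<nu> - sqrt (of_int (\<nu> + x0))) :: complex)"
    using r by simp
  hence "r\<^sup>2 = of_int \<nu> - sqrt (of_int (\<nu> + x0))" by (simp only: of_real_eq_iff)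
  hence "sqrt (of_int (\<nu> + x0)) \<le> of_int \<nu>" by (metis diff_ge_0_iff_ge zero_le_power2)
  hence "of_int (\<nu> + x0) \<le> (of_int \<nu> :: real)\<^sup>2" by (rule sqrt_le_D)
  hence "of_int (\<nu> + x0) \<le> (of_int (\<nu>\<^sup>2) :: real)" by (simp only: of_int_power)
  thus "x0 \<le> \<nu>\<^sup>2 - \<nu>" by (simp only: of_int_le_iff)
qed

lemma Omega_iff:
  "(\<nu>, x0) \<in> Omega \<longleftrightarrow>
    \<nu> \<ge> 2 \<and> x0 \<ge> 0 \<and> x0 \<le> \<nu>\<^sup>2 - \<nu> \<and> (\<forall>s. proper_sqrt_tower \<nu> x0 (xseq \<nu> x0 s))"
proof (intro iffI conjI allI)
  fix s assume "(\<nu>, x0) \<in> Omega"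
  hence "quadext (Kn \<nu> x0 s n) (Kn \<nu> x0 s (Suc n))" for n
    by (auto simp: Omega_def Kn_eq_tower_field quadext_iff_has_degree_2 subfield_tower_field)
  hence "xseq \<nu> x0 s (Suc n) \<notin> tower_field (xseq \<nu> x0 s) n" for n
    using quadext_psubset tower_field_subset_iff[OF subfield_tower_field]
    unfolding Kn_eq_tower_field by blast
  thus "proper_sqrt_tower \<nu> x0 (xseq \<nu> x0 s)"
    by (intro proper_sqrt_tower.intro sqrt_tower_xseq proper_sqrt_tower_axioms.intro)
next
  assume bounds_proper:
    "\<nu> \<ge> 2 \<and> x0 \<ge> 0 \<and> x0 \<le> \<nu>\<^sup>2 - \<nu> \<and> (\<forall>s. proper_sqrt_tower \<nu> x0 (xseq \<nu> x0 s))"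
  hence "has_degree (Kn \<nu> x0 s (Suc n)) (Kn \<nu> x0 s n) 2" for s n
    unfolding Kn_eq_tower_field
    by (intro quadext_imp_has_degree_2 proper_sqrt_tower.quadext_K) blast
  moreover have "totally_real (Kinf \<nu> x0 s)" for s
    unfolding Kinf_eq_Union_tower_field
    using sqrt_tower.totally_real_Union_K[OF sqrt_tower_xseq] bounds_proper by blast
  ultimately show "(\<nu>, x0) \<in> Omega" using bounds_proper by (auto simp: Omega_def)
qed (use Omega_bounds in blast)+

lemma u_ge:
  assumes "\<nu> \<ge> 3"
  shows "u \<nu> n \<ge> \<nu>\<^sup>2 - \<nu>"
proof (induction n)
  case (Suc n)
  have "\<nu>\<^sup>2 \<ge> 3 * \<nu>" using assms by (simp add: power2_eq_square)
  hence "u \<nu> n \<ge> \<nu>" "u \<nu> n \<ge> 2" using Suc assms by linarith+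
  moreover have "u \<nu> n * u \<nu> n \<ge> 2 * u \<nu> n" using \<open>u \<nu> n \<ge> 2\<close> by (intro mult_right_mono) auto
  moreover have "u \<nu> (Suc n) = u \<nu> n * u \<nu> n - \<nu>" by (simp add: power2_eq_square)
  ultimately show ?case using Suc by linarith
qed simp

lemma u_2 [simp]: "u 2 n = 2"
  by (induction n) auto

text \<open>With \<open>t = u\<^sub>j\<^sub>-\<^sub>1\<close>, the number \<open>u\<^sub>j - x\<^sub>0 = t\<^sup>2 - (\<nu> + x\<^sub>0)\<close> lies strictly between \<open>(t - 1)\<^sup>2\<close>
  and \<open>t\<^sup>2\<close>.\<close>

lemma u_minus_x0_nonsquare_if_bounded:
  fixes a :: int
  assumes "\<nu> \<ge> 3" "x0 \<ge> 0" "x0 \<le> \<nu>\<^sup>2 - \<nu>" "j \<ge> 1"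
  shows "u \<nu> j - x0 \<noteq> a\<^sup>2"
proof -
  obtain i where i: "j = Suc i" using assms by (cases j) auto
  define t where "t = u \<nu> i"
  have "t \<ge> \<nu>\<^sup>2 - \<nu>" unfolding t_def by (rule u_ge[OF assms(1)])
  moreover have "\<nu>\<^sup>2 \<ge> 3 * \<nu>" using assms by (simp add: power2_eq_square)
  ultimately have "t \<ge> 1" "\<nu> + x0 < 2 * t - 1" using assms by linarith+
  moreover have "(t - 1)\<^sup>2 = t\<^sup>2 - 2 * t + 1" by (simp add: power2_eq_square algebra_simps)
  moreover have "u \<nu> j - x0 = t\<^sup>2 - (\<nu> + x0)" by (simp add: i t_def)
  ultimately show ?thesis using assms by (intro int_square_not_between[of "t - 1"]) simp_all
qed

lemma Omega_rigid_sqrt_tower: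
  assumes \<Omega>: "(\<nu>, x0) \<in> Omega" and "\<nu> \<ge> 3 \<or> (\<nexists>a::int. u \<nu> 0 - x0 = a\<^sup>2)"
  shows "rigid_sqrt_tower \<nu> x0 (xseq \<nu> x0 s)"
proof (intro rigid_sqrt_tower.intro rigid_sqrt_tower_axioms.intro)
  show "proper_sqrt_tower \<nu> x0 (xseq \<nu> x0 s)" using \<Omega> by (simp add: Omega_iff)
  fix j :: nat and a :: int assume j: "j \<ge> 1"
  show "u \<nu> j - x0 \<noteq> a\<^sup>2"
  proof (cases "\<nu> \<ge> 3")
    case True
    thus ?thesis using u_minus_x0_nonsquare_if_bounded[OF _ Omega_bounds(2,3)[OF \<Omega>] j] by blast
  next
    case False
    hence "\<nu> = 2" using Omega_bounds(1)[OF \<Omega>] by simp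
    hence "u \<nu> j = u \<nu> 0" by simp
    thus ?thesis using assms(2) False by auto
  qed
qed

lemma Omega_nonsquare_proper_subfields:
  assumes "(\<nu>, x0) \<in> Omega" "\<nexists>a::int. u \<nu> 0 - x0 = a\<^sup>2"
  shows "proper_subfields_of (Kinf \<nu> x0 s) = range (Kn \<nu> x0 s)"
proof -
  interpret rigid_sqrt_tower \<nu> x0 "xseq \<nu> x0 s" using assms by (intro Omega_rigid_sqrt_tower) auto
  show ?thesis
    unfolding Kn_eq_tower_field Kinf_eq_Union_tower_field
    by (rule proper_subfields_of_Union_nonsquare[OF assms(2)])
qed

lemma Omega_square_sqrt_tower:
  assumes "(\<nu>, x0) \<in> Omega" "u \<nu> 0 - x0 = a\<^sup>2" "\<nu> \<ge> 3"
  shows "square_sqrt_tower \<nu> x0 (xseq \<nu> x0 s) a"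
  using assms
  by (intro square_sqrt_tower.intro square_sqrt_tower_axioms.intro Omega_rigid_sqrt_tower) auto

lemma Omega_square_proper_subfields:
  assumes "(\<nu>, x0) \<in> Omega" "u \<nu> 0 - x0 = a\<^sup>2" "\<nu> \<ge> 3"
  shows "proper_subfields_of (Kinf \<nu> x0 s) = range (Kn \<nu> x0 s) \<union>
    {adjoin \<rat> {sqrtC (2 * (\<nu> - a))}, adjoin \<rat> {sqrtC (2 * (\<nu> + a))}}"
proof -
  interpret square_sqrt_tower \<nu> x0 "xseq \<nu> x0 s" a by (rule Omega_square_sqrt_tower[OF assms])
  show ?thesis
    unfolding Kn_eq_tower_field Kinf_eq_Union_tower_field
    using proper_subfields_of_Union_square W_eq_sqrtC[of a] W_eq_sqrtC[of "- a"] by simp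
qed

lemma Omega_square_quadratic_subfields:
  fixes a :: int
  assumes "(\<nu>, x0) \<in> Omega" "u \<nu> 0 - x0 = a\<^sup>2" "\<nu> \<ge> 3"
  defines "Q \<equiv> \<lambda>d. adjoin \<rat> {sqrtC (2 * d)}"
  shows "has_degree (Q (\<nu> - a)) \<rat> 2" "has_degree (Q (\<nu> + a)) \<rat> 2" "Q (\<nu> - a) \<noteq> Q (\<nu> + a)"
    "Q (\<nu> - a) \<notin> range (Kn \<nu> x0 s)" "Q (\<nu> + a) \<notin> range (Kn \<nu> x0 s)"
    "Q (\<nu> - a) \<subseteq> Kn \<nu> x0 s 2" "Q (\<nu> + a) \<subseteq> Kn \<nu> x0 s 2"
proof -
  interpret square_sqrt_tower \<nu> x0 "xseq \<nu> x0 s" a by (rule Omega_square_sqrt_tower[OF assms(1-3)])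
  have W: "Q (\<nu> + a) = W a" "Q (\<nu> - a) = W (- a)"
    using W_eq_sqrtC[of a] W_eq_sqrtC[of "- a"] by (simp_all add: Q_def)
  show "has_degree (Q (\<nu> - a)) \<rat> 2" "has_degree (Q (\<nu> + a)) \<rat> 2" "Q (\<nu> - a) \<noteq> Q (\<nu> + a)"
    "Q (\<nu> - a) \<notin> range (Kn \<nu> x0 s)" "Q (\<nu> + a) \<notin> range (Kn \<nu> x0 s)"
    "Q (\<nu> - a) \<subseteq> Kn \<nu> x0 s 2" "Q (\<nu> + a) \<subseteq> Kn \<nu> x0 s 2"
    unfolding W Kn_eq_tower_field
    by (simp_all add: quadext_imp_has_degree_2 quadext_W W_notin_range W_subset_K_2
        distinct_W(1)[symmetric])
qed

subsection \<open>An infinite family in the square case\<close>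

lemma square_neq_2_mod_4:
  fixes a :: int
  shows "a\<^sup>2 \<noteq> 4 * m + 2"
proof
  assume a: "a\<^sup>2 = 4 * m + 2"
  hence "even (a\<^sup>2)" by simp
  then obtain b where "a = 2 * b" by (auto elim: evenE)
  hence "2 * b\<^sup>2 = 2 * m + 1" using a by (simp add: power2_eq_square)
  thus False by presburger
qed

text \<open>A square root of \<open>\<nu> + x\<^sub>1\<close> in \<open>K\<^sub>1\<close> would have a trace whose square is \<open>2 (\<nu> \<plusminus> 1)\<close>; this is
  \<open>2\<close> modulo \<open>4\<close> when \<open>\<nu>\<close> is a multiple of \<open>4\<close>.\<close>

lemma Omega_family:
  fixes k :: int
  assumes "k \<ge> 1"
  defines "\<nu> \<equiv> 4 * k"
  shows "(\<nu>, \<nu>\<^sup>2 - \<nu> - 1) \<in> Omega"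
proof -
  let ?x0 = "\<nu>\<^sup>2 - \<nu> - 1"
  have \<nu>: "\<nu> \<ge> 4" using assms by simp
  hence "\<nu>\<^sup>2 \<ge> 4 * \<nu>" by (simp add: power2_eq_square)
  hence bounds: "?x0 \<ge> 0" "?x0 \<le> \<nu>\<^sup>2 - \<nu>" using \<nu> by linarith+
  have "proper_sqrt_tower \<nu> ?x0 (xseq \<nu> ?x0 s)" for s
  proof (intro proper_sqrt_tower.intro sqrt_tower_xseq proper_sqrt_tower_axioms.intro
      sqrt_tower.generator_notin_predecessor[OF sqrt_tower_xseq])
    fix a b :: int and j :: nat
    show "\<nu> + ?x0 \<noteq> a\<^sup>2"
      using \<nu>
      by (intro int_square_not_between[of "\<nu> - 1"]) (simp_all add: power2_eq_square algebra_simps)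
    show "2 * (\<nu> + b) \<noteq> a\<^sup>2" if "u \<nu> 0 - ?x0 = b\<^sup>2"
    proof -
      have "b\<^sup>2 = 1" using that by simp
      hence "2 * (\<nu> + b) = 4 * (2 * k) + 2 \<or> 2 * (\<nu> + b) = 4 * (2 * k - 1) + 2"
        by (auto simp: power2_eq_1_iff \<nu>_def)
      thus ?thesis using square_neq_2_mod_4 by metis
    qed
    show "u \<nu> j - ?x0 \<noteq> a\<^sup>2" if "j \<ge> 1"
      using u_minus_x0_nonsquare_if_bounded[OF _ bounds that] \<nu> by simp
  qed
  thus ?thesis using \<nu> bounds by (simp add: Omega_iff)
qed

lemma infinite_Omega_square:
  "infinite {(\<nu>, x0). (\<nu>, x0) \<in> Omega \<and> \<nu> \<ge> 3 \<and> (\<exists>a::int. u \<nu> 0 - x0 = a\<^sup>2)}" (is "infinite ?S")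
proof -
  define f :: "nat \<Rightarrow> int \<times> int" where
    "f m = (let \<nu> = 4 * (int m + 1) in (\<nu>, \<nu>\<^sup>2 - \<nu> - 1))" for m
  have "f m \<in> ?S" for m
    using Omega_family[of "int m + 1"] by (auto simp: f_def Let_def intro: exI[of _ 1])
  moreover have "inj f" by (rule injI) (simp add: f_def Let_def)
  ultimately show ?thesis by (meson image_subsetI infinite_super range_inj_infinite)
qed

section \<open>The towers \<open>(2, 0)\<close> and \<open>(2, 1)\<close>\<close>

subsection \<open>Twice the cosine\<close>

definition two_cos :: "real \<Rightarrow> complex" where "two_cos \<theta> = of_real (2 * cos \<theta>)"

lemma two_cos_mult: "two_cos \<alpha> * two_cos \<beta> = two_cos (\<alpha> + \<beta>) + two_cos (\<alpha> - \<beta>)"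
  unfolding two_cos_def of_real_mult[symmetric] of_real_add[symmetric] of_real_eq_iff
  by (simp add: cos_times_cos)

lemma two_cos_0: "two_cos 0 = 2"
  by (simp add: two_cos_def)

lemma two_cos_minus [simp]: "two_cos (- \<theta>) = two_cos \<theta>"
  by (simp add: two_cos_def)

lemma two_cos_double: "two_cos (2 * \<theta>) = (two_cos \<theta>)\<^sup>2 - 2"
  using two_cos_mult[of \<theta> \<theta>] by (simp add: power2_eq_square two_cos_0)

lemma two_cos_plus_pi: "two_cos (\<theta> + pi) = - two_cos \<theta>"
  by (simp add: two_cos_def)

lemma two_cos_nat_mult_mem:
  assumes F: "subfield F CC" and \<theta>: "two_cos \<theta> \<in> F"
  shows "two_cos (of_nat n * \<theta>) \<in> F"
proof (induction n rule: induct_nat_012)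
  case 0
  show ?case using subfield_numeral[OF F] by (simp add: two_cos_0)
next
  case 1
  show ?case using \<theta> by simp
next
  case (ge2 n)
  have "two_cos (of_nat (Suc (Suc n)) * \<theta>) =
      two_cos (of_nat (Suc n) * \<theta>) * two_cos \<theta> - two_cos (of_nat n * \<theta>)"
    by (simp add: two_cos_mult algebra_simps)
  thus ?case using ge2 \<theta> F by (simp add: subfield_diff subfield_mult)
qed

lemma two_cos_int_mult_mem:
  assumes "subfield F CC" "two_cos \<theta> \<in> F"
  shows "two_cos (of_int k * \<theta>) \<in> F"
proof -
  have "two_cos (of_int k * \<theta>) = two_cos (of_nat (nat \<bar>k\<bar>) * \<theta>)"
    by (simp add: two_cos_def abs_if)
  thus ?thesis using two_cos_nat_mult_mem[OF assms, of "nat \<bar>k\<bar>"] by simp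
qed

text \<open>An odd \<open>j\<close> is invertible modulo \<open>2\<^sup>n\<^sup>+\<^sup>1\<close>, the denominator of \<open>\<pi> / 2\<^sup>n\<close> as a
  fraction of a full turn.\<close>

lemma two_cos_odd_multiple:
  assumes "odd j"
  shows "\<exists>m. two_cos (of_int i * (pi / 2 ^ n)) = two_cos (of_int m * (of_int j * (pi / 2 ^ n)))"
proof -
  define \<alpha> where "\<alpha> = pi / 2 ^ n"
  have "coprime j (2 ^ Suc n)"
    using assms by (simp only: coprime_power_right_iff coprime_right_2_iff_odd) simp
  then obtain a b where ab: "a * j + b * 2 ^ Suc n = 1"
    using bezout_int[of j "2 ^ Suc n"] by auto
  have "i = (i * a) * j + (i * b) * 2 ^ Suc n"
    using arg_cong[OF ab, of "\<lambda>t. i * t"] by (simp add: algebra_simps)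
  hence "of_int i * \<alpha> = of_int ((i * a) * j + (i * b) * 2 ^ Suc n) * \<alpha>" by simp
  also have "\<dots> = of_int (i * a) * (of_int j * \<alpha>) + of_int (i * b) * (2 ^ Suc n * \<alpha>)"
    by (simp add: algebra_simps)
  also have "2 ^ Suc n * \<alpha> = 2 * pi" by (simp add: \<alpha>_def)
  finally have "two_cos (of_int i * \<alpha>) = two_cos (of_int (i * a) * (of_int j * \<alpha>))"
    using cos.plus_of_int[of "of_int (i * a) * (of_int j * \<alpha>)" "i * b"]
    by (simp only: two_cos_def of_real_eq_id id_apply)
  thus ?thesis unfolding \<alpha>_def by blast
qed

subsection \<open>The tower over \<open>0\<close>\<close>

lemma sqrt_tower_2_0_eq_two_cos:
  assumes "sqrt_tower 2 0 y"
  shows "\<exists>j. odd j \<and> y n = two_cos (of_int j * (pi / 2 ^ Suc n))"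
proof (induction n)
  case 0
  show ?case using sqrt_tower.x_0[OF assms] by (intro exI[of _ 1]) (simp add: two_cos_def)
next
  case (Suc n)
  then obtain j where j: "odd j" "y n = two_cos (of_int j * (pi / 2 ^ Suc n))" by blast
  define \<phi> where "\<phi> = of_int j * (pi / 2 ^ Suc (Suc n))"
  have "y n = two_cos (2 * \<phi>)" using j(2) by (simp add: \<phi>_def mult.commute)
  hence "(y (Suc n))\<^sup>2 = (two_cos \<phi>)\<^sup>2"
    using sqrt_tower.x_Suc[OF assms, of n] by (simp add: two_cos_double)
  hence "y (Suc n) = two_cos \<phi> \<or> y (Suc n) = two_cos (\<phi> + pi)"
    by (simp add: power2_eq_iff two_cos_plus_pi)
  moreover have "\<phi> + pi = of_int (j + 2 ^ Suc (Suc n)) * (pi / 2 ^ Suc (Suc n))"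
    by (simp add: \<phi>_def distrib_right)
  moreover have "odd (j + 2 ^ Suc (Suc n))" using j(1) by simp
  ultimately show ?case using j(1) unfolding \<phi>_def by metis
qed

lemma tower_field_2_0_unique:
  assumes "sqrt_tower 2 0 y" "sqrt_tower 2 0 y'"
  shows "tower_field y = tower_field y'"
proof -
  have "y' n \<in> tower_field y n" if tower: "sqrt_tower 2 0 y" "sqrt_tower 2 0 y'" for y y' n
  proof -
    let ?\<alpha> = "pi / 2 ^ Suc n"
    obtain j where j: "odd j" "y n = two_cos (of_int j * ?\<alpha>)"
      using sqrt_tower_2_0_eq_two_cos[OF tower(1)] by blast
    obtain i where "y' n = two_cos (of_int i * ?\<alpha>)"
      using sqrt_tower_2_0_eq_two_cos[OF tower(2)] by blast
    then obtain m where "y' n = two_cos (of_int m * (of_int j * ?\<alpha>))"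
      using two_cos_odd_multiple[OF j(1)] by metis
    thus ?thesis
      using two_cos_int_mult_mem[OF subfield_tower_field] mem_tower_field[of y n] j(2) by metis
  qed
  from this[OF assms] this[OF assms(2,1)] show ?thesis
    by (intro ext equalityI) (simp_all add: tower_field_subset_iff subfield_tower_field)
qed

lemma sqrt_tower_2_0_rigid:
  assumes "sqrt_tower 2 0 y"
  shows "rigid_sqrt_tower 2 0 y"
proof -
  have nonsquare: "2 \<noteq> a\<^sup>2" for a :: int by (rule int_square_not_between[of 1]) simp_all
  show ?thesis
    using assms nonsquare sqrt_tower.generator_notin_predecessor[OF assms]
    by (intro rigid_sqrt_tower.intro proper_sqrt_tower.intro proper_sqrt_tower_axioms.intro
        rigid_sqrt_tower_axioms.intro) auto
qed

subsection \<open>The two towers together\<close>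

locale two_towers = L: rigid_sqrt_tower 2 0 y + K: sqrt_tower 2 1 x for y x
begin

abbreviation L :: "nat \<Rightarrow> complex set" where "L \<equiv> tower_field y"

abbreviation K :: "nat \<Rightarrow> complex set" where "K \<equiv> tower_field x"

abbreviation r :: complex where "r \<equiv> sqrtC 3"

abbreviation M :: "nat \<Rightarrow> complex set" where "M \<equiv> tower_field (\<lambda>n. r * y n)"

lemma r_square: "r\<^sup>2 = 3"
  unfolding sqrtC_def power2_csqrt by simp

lemma r_square_mem: "subfield F CC \<Longrightarrow> r\<^sup>2 \<in> F"
  by (simp add: r_square subfield_numeral)

lemma y_0: "y 0 = 0" and y_Suc: "(y (Suc n))\<^sup>2 = 2 + y n"
  using L.x_0 L.x_Suc[of n] by simp_all

lemma x_0: "x 0 = 1" and x_Suc: "(x (Suc n))\<^sup>2 = 2 + x n"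
  using K.x_0 K.x_Suc[of n] by simp_all

lemma two_minus_y_nonsquare: "c \<in> L k \<Longrightarrow> c\<^sup>2 \<noteq> 2 - y k"
  using L.u_minus_x_square_imp[OF L.x_Suc_notin, of c k 0] L.u_minus_x0_nonsquare[of 1] by auto

lemma r_notin_L: "r \<notin> L n"
proof
  assume "r \<in> L n"
  hence "r \<in> L (Suc 0)"
    using L.square_mem_K_descends_to[of 0 r n] two_minus_y_nonsquare r_square_mem[OF L.subfield_K]
    by simp
  moreover have "r \<notin> \<rat>"
  proof
    assume "r \<in> \<rat>"
    then obtain a :: int where "3 = a\<^sup>2" using r_square by (auto elim: Rats_sqrt_of_intE[of _ 3])
    thus False using int_square_not_between[of 1 3 a] by simp
  qed
  ultimately have "r * y (Suc 0) \<in> \<rat>"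
    using sqrt_extension.sqrt_mult_mem[OF L.sqrt_extension_Suc[of 0], of r] L.K_Suc[of 0] L.K_0
      r_square_mem[OF subfield_Rats] by simp
  moreover have "(r * y (Suc 0))\<^sup>2 = of_int 6" by (simp add: power_mult_distrib r_square y_Suc y_0)
  ultimately obtain a :: int where "6 = a\<^sup>2" by (rule Rats_sqrt_of_intE)
  thus False using int_square_not_between[of 2 6 a] by simp
qed

lemma sqrt_extension_r: "sqrt_extension (L n) r"
  by (intro sqrt_extension.intro L.subfield_K r_square_mem r_notin_L)

text \<open>The triple-angle map \<open>2 cos \<theta> \<mapsto> 2 cos 3\<theta>\<close> takes the tower over \<open>1\<close> to a tower over \<open>0\<close>.\<close>

definition z :: "nat \<Rightarrow> complex" where "z n = x (Suc n) * ((x (Suc n))\<^sup>2 - 3)"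

lemma sqrt_tower_z: "sqrt_tower 2 0 z"
proof
  show "z 0 = of_int 0" using x_Suc[of 0] x_0 by (simp add: z_def)
  fix n
  have "(z (Suc n))\<^sup>2 = (x (Suc (Suc n)))\<^sup>2 * ((x (Suc (Suc n)))\<^sup>2 - 3)\<^sup>2"
    by (simp add: z_def power_mult_distrib)
  also have "\<dots> = 2 + x (Suc n) * ((x (Suc n))\<^sup>2 - 3)"
    unfolding x_Suc[of "Suc n"] by (simp add: power2_eq_square algebra_simps)
  finally show "(z (Suc n))\<^sup>2 = of_int 2 + z n" by (simp add: z_def)
qed

lemma L_eq_tower_field_z: "L = tower_field z"
  by (rule tower_field_2_0_unique[OF L.sqrt_tower_axioms sqrt_tower_z])

lemma x_neq_1: "x (Suc n) \<noteq> 1"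
proof -
  have "(x (Suc n))\<^sup>2 \<noteq> 1"
  proof (induction n)
    case 0
    show ?case by (simp add: x_Suc x_0)
  next
    case (Suc n)
    have "x (Suc n) \<noteq> - 1" using Suc by auto
    thus ?case by (simp add: x_Suc[of "Suc n"] eq_neg_iff_add_eq_0 add.commute)
  qed
  thus ?thesis by auto
qed

lemma x_1_cases: "x (Suc 0) = r \<or> x (Suc 0) = - r"
  using x_Suc[of 0] x_0 r_square by (simp add: power2_eq_iff[symmetric])

lemma x_Suc_mem_adjoin: "x (Suc n) \<in> adjoin (L n) {r}"
proof (induction n)
  case 0
  show ?case using x_1_cases mem_adjoin subfield_uminus[OF subfield_adjoin mem_adjoin] by metis
next
  case (Suc n)
  let ?A = "adjoin (L (Suc n)) {r}"
  have "L n \<subseteq> ?A" by (rule subset_trans[OF L.K_mono subset_adjoin(1)]) simp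
  hence "adjoin (L n) {r} \<subseteq> ?A" by (simp add: adjoin_subset_iff subfield_adjoin mem_adjoin)
  hence "x (Suc n) \<in> ?A" using Suc by blast
  moreover have "z (Suc n) \<in> ?A"
    using mem_tower_field[of z "Suc n"] L_eq_tower_field_z subset_adjoin(1) by auto
  moreover have "x (Suc (Suc n)) = z (Suc n) / (x (Suc n) - 1)"
    using x_neq_1[of n] by (simp add: z_def x_Suc[of "Suc n"])
  ultimately show ?case by (simp add: subfield_closed subfield_adjoin)
qed

lemma K_Suc_eq: "K (Suc n) = adjoin (L n) {r}"
proof (rule equalityI)
  show "K (Suc n) \<subseteq> adjoin (L n) {r}"
    using x_Suc_mem_adjoin by (simp add: tower_field_subset_iff subfield_adjoin)
  have "z n \<in> K (Suc n)" unfolding z_def by (intro subfield_closed K.subfield_K K.x_mem_K)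
  hence "L n \<subseteq> K (Suc n)"
    by (simp add: L_eq_tower_field_z tower_field_subset_iff subfield_tower_field)
  moreover have "x (Suc 0) \<in> K (Suc n)" by (rule K.x_mem_K_le) simp
  hence "r \<in> K (Suc n)" using x_1_cases subfield_uminus[OF K.subfield_K, of "x (Suc 0)" "Suc n"]
    by auto
  ultimately show "adjoin (L n) {r} \<subseteq> K (Suc n)" by (simp add: adjoin_subset_iff K.subfield_K)
qed

lemma r_mult_y_notin_L: "r * y (Suc n) \<notin> L m"
proof
  let ?k = "max m (Suc n)"
  assume "r * y (Suc n) \<in> L m"
  hence "r * y (Suc n) \<in> L ?k" "y (Suc n) \<in> L ?k"
    using L.K_mono[of m ?k] L.x_mem_K_le[of "Suc n" ?k] by auto
  hence "r * y (Suc n) / y (Suc n) \<in> L ?k" by (intro subfield_divide L.subfield_K)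
  thus False using r_notin_L L.x_Suc_nonzero by simp
qed

lemma biquadratic_L: "biquadratic_extension (L n) r (y (Suc n))"
  by (intro biquadratic_extension.intro sqrt_extension_r L.sqrt_extension_Suc r_mult_y_notin_L)

lemma K_Suc_Suc_eq: "K (Suc (Suc n)) = adjoin (L n) {r, y (Suc n)}"
  unfolding K_Suc_eq L.K_Suc by (simp add: insert_commute flip: adjoin_insert)

lemma r_mult_y_square: "(r * y (Suc n))\<^sup>2 = 3 * (2 + y n)"
  by (simp add: power_mult_distrib r_square y_Suc)

lemma M_Suc_eq: "M (Suc n) = adjoin (L n) {r * y (Suc n)}"
proof (rule equalityI)
  show "M (Suc n) \<subseteq> adjoin (L n) {r * y (Suc n)}"
    by (simp add: tower_field_subset_iff subfield_adjoin mem_adjoin)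
  have mem: "r * y (Suc n) \<in> M (Suc n)" by (rule mem_tower_field)
  have "y n = (r * y (Suc n))\<^sup>2 / 3 - 2" by (simp add: r_mult_y_square)
  also have "\<dots> \<in> M (Suc n)" by (intro subfield_closed subfield_tower_field mem)
  finally have "L n \<subseteq> M (Suc n)" by (simp add: tower_field_subset_iff subfield_tower_field)
  thus "adjoin (L n) {r * y (Suc n)} \<subseteq> M (Suc n)"
    using mem by (simp add: adjoin_subset_iff subfield_tower_field)
qed

lemma quadext_L_K: "quadext (L n) (K (Suc n))"
  unfolding K_Suc_eq by (rule quadext_adjoin[OF sqrt_extension_r])

lemma quadext_L_M: "quadext (L n) (M (Suc n))"
  unfolding M_Suc_eq
  using biquadratic_extension.fst_mult[OF biquadratic_L] biquadratic_extension.sqrt_extension_snd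
  by (blast intro: quadext_adjoin)

subsection \<open>Subfields of index two\<close>

lemma two_minus_y_square: "\<exists>d\<in>L (Suc k). d\<^sup>2 = 2 - y k"
proof (induction k)
  case 0
  show ?case using L.x_mem_K[of "Suc 0"] by (intro bexI[of _ "y (Suc 0)"]) (simp_all add: y_Suc y_0)
next
  case (Suc k)
  then obtain d where d: "d \<in> L (Suc k)" "d\<^sup>2 = 2 - y k" by blast
  have "d / y (Suc (Suc k)) \<in> L (Suc (Suc k))"
    using d(1) L.K_mono[of "Suc k" "Suc (Suc k)"] L.x_mem_K
    by (intro subfield_divide L.subfield_K) auto
  moreover have "(2 - y (Suc k)) * (y (Suc (Suc k)))\<^sup>2 = 4 - (y (Suc k))\<^sup>2"
    unfolding y_Suc[of "Suc k"] by (simp add: algebra_simps power2_eq_square)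
  hence "d\<^sup>2 = (2 - y (Suc k)) * (y (Suc (Suc k)))\<^sup>2" by (simp add: d(2) y_Suc[of k])
  hence "(d / y (Suc (Suc k)))\<^sup>2 = 2 - y (Suc k)"
    using L.x_Suc_nonzero[of "Suc k"] by (simp add: power_divide)
  ultimately show ?case by blast
qed

text \<open>If \<open>\<tau>\<close> moves \<open>y\<^sub>k\<^sub>+\<^sub>1\<close>, then \<open>w \<tau> w\<close> is fixed and lies in \<open>L\<^sub>k\<^sub>+\<^sub>1\<close>, hence in \<open>L\<^sub>k\<close>; but up to
  the factor \<open>c\<close> it is a square root of \<open>2 - y\<^sub>k\<close>.\<close>

lemma involution_fixes_y_Suc:
  assumes \<tau>: "field_involution T \<tau>" and w: "w \<in> T" "w\<^sup>2 = c * (2 + y (Suc k))"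
    and c: "c \<in> \<rat>" "c \<noteq> 0" and y: "y k \<in> fixed_field T \<tau>" "y (Suc k) \<in> T"
  shows "y (Suc k) \<in> fixed_field T \<tau>"
proof (rule ccontr)
  let ?F = "fixed_field T \<tau>"
  interpret \<tau>: field_involution T \<tau> by (rule \<tau>)
  have F: "subfield ?F CC" by (rule \<tau>.subfield_fixed_field)
  assume moved: "y (Suc k) \<notin> ?F"
  have "(y (Suc k))\<^sup>2 \<in> ?F" using y(1) F by (simp add: y_Suc subfield_closed)
  hence \<tau>_y: "\<tau> (y (Suc k)) = - y (Suc k)"
    using \<tau>.hom_sqrt_cases[OF y(2)] moved y(2) by (auto simp: fixed_field_def)
  define b where "b = w * \<tau> w"
  have b_fixed: "b \<in> ?F" unfolding b_def by (rule \<tau>.mult_conj_fixed[OF w(1)])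
  have b_square: "b\<^sup>2 = c\<^sup>2 * (2 - y k)"
    using L.conj_product_square[OF \<tau> w(1) _ c(1) y(2) \<tau>_y] w(2) by (simp add: b_def)
  obtain d where d: "d \<in> L (Suc k)" "d\<^sup>2 = 2 - y k" using two_minus_y_square by blast
  hence "b\<^sup>2 = (c * d)\<^sup>2" using b_square by (simp add: power_mult_distrib)
  hence "b = c * d \<or> b = - (c * d)" by (simp add: power2_eq_iff)
  moreover have c_mem: "c \<in> L n" for n using c(1) Rats_subset_subfield[OF L.subfield_K] by blast
  ultimately have "b \<in> L (Suc k)" using d(1) L.subfield_K by (auto simp: subfield_closed)
  hence "b \<in> L k" using L.Int_K_Suc[OF F y(1) moved] b_fixed by blast
  hence "b / c \<in> L k" using c_mem by (intro subfield_divide L.subfield_K)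
  moreover have "(b / c)\<^sup>2 = 2 - y k" using b_square c(2) by (simp add: power_divide)
  ultimately show False using two_minus_y_nonsquare by blast
qed

lemma involution_fixes_y:
  assumes \<tau>: "field_involution T \<tau>" and w: "w \<in> T" "w\<^sup>2 = c * (2 + y k)" and c: "c \<in> \<rat>" "c \<noteq> 0"
  shows "y k \<in> fixed_field T \<tau>"
  using w c
proof (induction k arbitrary: w c)
  case 0
  show ?case
    using \<tau> subfield_embedding.subfield_fixed_field
    by (simp add: y_0 subfield_zero field_involution_def)
next
  case (Suc k)
  have T: "subfield T CC" using \<tau> by (simp add: field_involution_def subfield_embedding_def)
  hence "c \<in> T" using Suc.prems(3) Rats_subset_subfield by blast
  moreover have "y (Suc k) = w\<^sup>2 / c - 2" using Suc.prems by simp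
  ultimately have y: "y (Suc k) \<in> T" using Suc.prems(1) T by (simp add: subfield_closed)
  hence "y k \<in> fixed_field T \<tau>" using Suc.IH[of "y (Suc k)" 1] y_Suc[of k] by simp
  thus ?case using involution_fixes_y_Suc[OF \<tau> Suc.prems] y by blast
qed

lemma quadext_contains_L:
  assumes "quadext E T" "w \<in> T" "w\<^sup>2 = c * (2 + y k)" "c \<in> \<rat>" "c \<noteq> 0"
  shows "L k \<subseteq> E"
proof -
  obtain \<tau> where \<tau>: "field_involution T \<tau>" "fixed_field T \<tau> = E" using assms(1)
    by (rule quadext_involution)
  show ?thesis
    using involution_fixes_y[OF \<tau>(1) assms(2-5)] \<tau>(2) quadext_subfield(1)[OF assms(1)]
    by (simp add: tower_field_subset_iff)
qed

definition level :: "nat \<Rightarrow> complex set set" where "level n = {L n, K n, M n}"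

lemma level_0: "level 0 = {\<rat>}"
proof -
  have "M 0 = \<rat>" unfolding tower_field_def y_0 by (simp add: adjoin_absorb subfield_Rats)
  thus ?thesis unfolding level_def L.K_0 K.K_0 by simp
qed

lemma subfield_level: "F \<in> level n \<Longrightarrow> subfield F CC"
  unfolding level_def using subfield_tower_field by blast

lemma quadext_level_K:
  assumes "F \<in> level n"
  shows "quadext F (K (Suc n))"
proof (cases n)
  case 0
  thus ?thesis using assms level_0 quadext_L_K[of 0] L.K_0 by simp
next
  case (Suc m)
  show ?thesis
    using assms unfolding Suc level_def K_Suc_Suc_eq K_Suc_eq[of m] L.K_Suc M_Suc_eq
    using biquadratic_extension.quadext_fst[OF biquadratic_L]
      biquadratic_extension.quadext_snd[OF biquadratic_L]
      biquadratic_extension.quadext_mult[OF biquadratic_L] by blast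
qed

lemma quadext_L_iff: "quadext E (L (Suc n)) \<longleftrightarrow> E = L n"
proof
  assume E: "quadext E (L (Suc n))"
  have "L n \<subseteq> E" using quadext_contains_L[OF E L.x_mem_K, of 1] by (simp add: y_Suc)
  thus "E = L n" by (rule quadext_base_unique[OF L.quadext_K E])
qed (use L.quadext_K in simp)

lemma quadext_M_iff: "quadext E (M (Suc n)) \<longleftrightarrow> E = L n"
proof
  assume E: "quadext E (M (Suc n))"
  have "L n \<subseteq> E" using quadext_contains_L[OF E mem_tower_field r_mult_y_square] by simp
  thus "E = L n" by (rule quadext_base_unique[OF quadext_L_M E])
qed (use quadext_L_M in simp)

lemma quadext_K_iff: "quadext E (K (Suc n)) \<longleftrightarrow> E \<in> level n"
proof
  assume E: "quadext E (K (Suc n))"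
  show "E \<in> level n"
  proof (cases n)
    case 0
    have "\<rat> \<subseteq> E" by (rule Rats_subset_subfield[OF quadext_subfield(1)[OF E]])
    hence "E = \<rat>" using quadext_base_unique[OF quadext_level_K E] level_0 0 by simp
    thus ?thesis using level_0 0 by simp
  next
    case (Suc m)
    have "y (Suc m) \<in> K (Suc n)" unfolding Suc K_Suc_Suc_eq using subset_adjoin(2) by blast
    hence "L m \<subseteq> E" using quadext_contains_L[OF E, of _ 1] by (simp add: y_Suc)
    thus ?thesis
      using biquadratic_extension.index_two_iff[OF biquadratic_L, of m E] E
      unfolding Suc K_Suc_Suc_eq level_def K_Suc_eq[of m] L.K_Suc M_Suc_eq by blast
  qed
qed (rule quadext_level_K)

lemma index_two_level_Suc:
  assumes "T \<in> level (Suc n)" "quadext E T"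
  shows "E \<in> level n"
  using assms quadext_L_iff quadext_M_iff quadext_K_iff by (auto simp: level_def)

lemma distinct_level: "distinct [L (Suc n), K (Suc n), M (Suc n)]"
  using biquadratic_extension.distinct_adjoin[OF biquadratic_L]
  unfolding K_Suc_eq[of n] L.K_Suc M_Suc_eq by auto

lemma quadext_L_level: "F \<in> level (Suc n) \<Longrightarrow> quadext (L n) F"
  using L.quadext_K quadext_L_K quadext_L_M by (auto simp: level_def)

lemma has_degree_level:
  assumes "F \<in> level n"
  shows "has_degree F \<rat> (2 ^ n)"
proof (cases n)
  case 0
  thus ?thesis using assms level_0 has_degree_self[OF subfield_Rats] by simp
next
  case (Suc m)
  thus ?thesis
    using assms has_degree_quadext[OF subfield_Rats L.has_degree_K quadext_L_level] by simp
qed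

subsection \<open>The lattice of subfields\<close>

definition L_inf :: "complex set" where "L_inf = (\<Union>n. L n)"

definition K_inf :: "complex set" where "K_inf = (\<Union>n. K n)"

lemma subfield_L_inf: "subfield L_inf CC" and subfield_K_inf: "subfield K_inf CC"
  unfolding L_inf_def K_inf_def by (rule L.subfield_Union_K K.subfield_Union_K)+

lemma level_subset_K_Suc: "F \<in> level n \<Longrightarrow> F \<subseteq> K (Suc n)"
  using quadext_psubset[OF quadext_level_K] by blast

lemma level_subset_K_inf: "F \<in> level n \<Longrightarrow> F \<subseteq> K_inf"
  unfolding K_inf_def using level_subset_K_Suc by blast

lemma K_inf_eq_adjoin: "K_inf = adjoin L_inf {r}"
proof (rule equalityI)
  have "K n \<subseteq> adjoin L_inf {r}" for n
  proof -
    have "L n \<subseteq> adjoin L_inf {r}" unfolding L_inf_def using subset_adjoin(1) by blast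
    hence "K (Suc n) \<subseteq> adjoin L_inf {r}"
      unfolding K_Suc_eq by (simp add: adjoin_subset_iff subfield_adjoin mem_adjoin)
    thus ?thesis using K.K_mono[of n "Suc n"] by auto
  qed
  thus "K_inf \<subseteq> adjoin L_inf {r}" unfolding K_inf_def by blast
  have "L n \<subseteq> K_inf" for n by (rule level_subset_K_inf[of _ n]) (simp add: level_def)
  hence "L_inf \<subseteq> K_inf" unfolding L_inf_def by blast
  moreover have "r \<in> K_inf" unfolding K_inf_def using K_Suc_eq[of 0] mem_adjoin by blast
  ultimately show "adjoin L_inf {r} \<subseteq> K_inf" by (simp add: adjoin_subset_iff subfield_K_inf)
qed

lemma quadext_L_inf_K_inf: "quadext L_inf K_inf"
  unfolding K_inf_eq_adjoin using r_notin_L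
  by (intro quadext_adjoin sqrt_extension.intro subfield_L_inf r_square_mem) (auto simp: L_inf_def)

lemma index_two_closed_levels: "index_two_closed (\<Union>n. level n)"
  unfolding index_two_closed_def
proof (intro ballI conjI allI impI)
  fix T assume "T \<in> (\<Union>n. level n)"
  then obtain n where T: "T \<in> level n" by blast
  show "quadratic_tower T"
  proof (cases n)
    case 0
    thus ?thesis using T level_0 quadratic_tower.Rats by simp
  next
    case (Suc m)
    thus ?thesis using T quadratic_tower_quadext[OF L.quadratic_tower_K quadext_L_level] by blast
  qed
  fix E assume E: "quadext E T"
  have "n \<noteq> 0"
  proof
    assume "n = 0"
    thus False
      using T E level_0 quadext_psubset[OF E] Rats_subset_subfield[OF quadext_subfield(1)[OF E]]
      by blast
  qed
  thus "E \<in> (\<Union>n. level n)" using T E index_two_level_Suc[of T "n - 1" E] by auto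
qed

lemma level_dichotomy:
  assumes "F \<in> level m"
  shows "F \<subseteq> K (Suc n) \<or> L n \<subseteq> F"
proof (cases "m \<le> n")
  case True
  thus ?thesis using level_subset_K_Suc[OF assms] K.K_mono[of "Suc m" "Suc n"] by auto
next
  case False
  then obtain k where k: "m = Suc k" "n \<le> k" by (cases m) auto
  hence "L k \<subseteq> F" using assms quadext_psubset[OF quadext_L_level] by blast
  thus ?thesis using L.K_mono[OF k(2)] by blast
qed

lemma subfields_of_K_inf: "subfields_of K_inf = {L_inf, K_inf} \<union> (\<Union>n. level n)"
proof (intro equalityI subsetI)
  fix F assume "F \<in> subfields_of K_inf"
  hence F: "subfield F CC" "F \<subseteq> K_inf" by (auto simp: subfields_of_def)
  have "F \<in> (\<Union>n. level n) \<or> L_inf \<subseteq> F"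
    unfolding L_inf_def
  proof (rule index_two_closed_Union[OF index_two_closed_levels _ _ F(1)])
    show "K n \<in> (\<Union>n. level n)" for n by (auto simp: level_def)
    show "G \<subseteq> K (Suc n) \<or> L n \<subseteq> G" if "G \<in> (\<Union>n. level n)" for G n
      using that level_dichotomy by blast
  qed (use F(2) in \<open>simp add: K_inf_def\<close>)
  thus "F \<in> {L_inf, K_inf} \<union> (\<Union>n. level n)"
    using quadext_intermediate_cases[OF quadext_L_inf_K_inf] F by blast
next
  fix F assume "F \<in> {L_inf, K_inf} \<union> (\<Union>n. level n)"
  thus "F \<in> subfields_of K_inf"
    using subfield_L_inf subfield_K_inf subfield_level level_subset_K_inf
      quadext_psubset[OF quadext_L_inf_K_inf]
    unfolding subfields_of_def by blast
qed

lemma infinite_degree_if_L_inf_subset: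
  assumes "L_inf \<subseteq> F"
  shows "infinite_degree F \<rat>"
proof -
  have "\<not> has_degree F \<rat> d" for d
  proof
    assume d: "has_degree F \<rat> d"
    have "L d \<subseteq> F" using assms by (auto simp: L_inf_def)
    hence "2 ^ d \<le> d" using has_degree_mono[OF subfield_Rats L.has_degree_K d] by blast
    thus False using less_exp[of d] by linarith
  qed
  moreover have "\<rat> \<subseteq> F" using assms Rats_subset_subfield[OF subfield_L_inf] by blast
  ultimately show ?thesis unfolding infinite_degree_def by blast
qed

lemma infinite_degree_proper_subfields:
  "{F \<in> proper_subfields_of K_inf. infinite_degree F \<rat>} = {L_inf}"
proof -
  have "proper_subfields_of K_inf = subfields_of K_inf - {K_inf}"
    by (auto simp: proper_subfields_of_def subfields_of_def)
  moreover have "\<not> infinite_degree F \<rat>" if "F \<in> level n" for F n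
    using has_degree_level[OF that] by (auto simp: infinite_degree_def)
  moreover have "infinite_degree L_inf \<rat>" by (simp add: infinite_degree_if_L_inf_subset)
  moreover have "L_inf \<noteq> K_inf" using quadext_psubset[OF quadext_L_inf_K_inf] by blast
  ultimately show ?thesis unfolding subfields_of_K_inf by auto
qed

lemma subfields_of_degree: "{F \<in> subfields_of K_inf. has_degree F \<rat> (2 ^ n)} = level n"
proof (intro equalityI subsetI)
  fix F assume "F \<in> {F \<in> subfields_of K_inf. has_degree F \<rat> (2 ^ n)}"
  hence F: "F \<in> subfields_of K_inf" "has_degree F \<rat> (2 ^ n)" by auto
  hence "\<not> L_inf \<subseteq> F" using infinite_degree_if_L_inf_subset by (auto simp: infinite_degree_def)
  then obtain m where m: "F \<in> level m"
    using F(1) quadext_psubset[OF quadext_L_inf_K_inf] unfolding subfields_of_K_inf by blast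
  have "(2::nat) ^ m = 2 ^ n"
    by (rule has_degree_unique[OF subfield_Rats has_degree_level[OF m] F(2)])
  thus "F \<in> level n" using m by simp
qed (use has_degree_level subfields_of_K_inf in auto)

lemma index_two_of_L_inf_superset:
  assumes "L_inf \<subseteq> T" "T \<subseteq> K_inf" "quadext E T"
  shows "E = L_inf \<and> T = K_inf"
proof -
  have E: "subfield E CC" "E \<subset> T" using assms(3) quadext_subfield(1) quadext_psubset by blast+
  hence "E \<in> subfields_of K_inf" using assms(2) by (auto simp: subfields_of_def)
  moreover have "E \<notin> level n" for n
  proof
    assume "E \<in> level n"
    hence "has_degree T \<rat> (2 * 2 ^ n)"
      using has_degree_quadext[OF subfield_Rats has_degree_level assms(3)] by blast
    thus False using infinite_degree_if_L_inf_subset[OF assms(1)]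
      by (auto simp: infinite_degree_def)
  qed
  ultimately have "E = L_inf" using E(2) assms(2) unfolding subfields_of_K_inf by blast
  moreover from this have "T = K_inf"
    using quadext_intermediate_cases[OF quadext_L_inf_K_inf quadext_subfield(2)[OF assms(3)]]
      assms E(2)
    by blast
  ultimately show ?thesis ..
qed

lemma quadext_subfields_of_K_inf_cases:
  assumes E: "E \<in> subfields_of K_inf" and FE: "quadext F E"
  obtains (limit) "F = L_inf" "E = K_inf"
  | (from_L) n where "F = L n" "E = L (Suc n) \<or> E = M (Suc n)"
  | (to_K) n where "F \<in> level n" "E = K (Suc n)"
proof (cases "\<exists>n. E \<in> level n")
  case True
  then obtain n where n: "E \<in> level n" by blast
  show ?thesis
  proof (cases n)
    case 0
    hence "E \<subseteq> F" using n level_0 Rats_subset_subfield[OF quadext_subfield(1)[OF FE]] by simp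
    thus ?thesis using quadext_psubset[OF FE] by blast
  next
    case (Suc m)
    hence "E = L (Suc m) \<or> E = K (Suc m) \<or> E = M (Suc m)" using n by (auto simp: level_def)
    thus ?thesis using FE quadext_L_iff quadext_K_iff quadext_M_iff from_L to_K by metis
  qed
next
  case False
  hence "L_inf \<subseteq> E" "E \<subseteq> K_inf" using E quadext_psubset[OF quadext_L_inf_K_inf]
    unfolding subfields_of_K_inf by auto
  thus ?thesis using index_two_of_L_inf_superset[OF _ _ FE] limit by blast
qed

lemma degree_two_pairs:
  "{(F, E). F \<in> subfields_of K_inf \<and> E \<in> subfields_of K_inf \<and> has_degree E F 2} =
    insert (L_inf, K_inf) (\<Union>n. {(L n, L (Suc n)), (L n, M (Suc n))} \<union> level n \<times> {K (Suc n)})"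
  (is "?pairs = ?steps")
proof (intro equalityI subrelI)
  fix F E assume "(F, E) \<in> ?pairs"
  hence "E \<in> subfields_of K_inf" "quadext F E"
    by (auto simp: subfields_of_def quadext_iff_has_degree_2)
  thus "(F, E) \<in> ?steps" by (cases rule: quadext_subfields_of_K_inf_cases) blast+
next
  fix F E assume "(F, E) \<in> ?steps"
  then consider "F = L_inf" "E = K_inf" | n where "F = L n" "E = L (Suc n) \<or> E = M (Suc n)"
    | n where "F \<in> level n" "E = K (Suc n)" by blast
  hence "quadext F E \<and> E \<in> subfields_of K_inf"
    by cases (use quadext_L_inf_K_inf quadext_L_iff quadext_M_iff quadext_level_K in
        \<open>auto simp: subfields_of_K_inf level_def\<close>)
  thus "(F, E) \<in> ?pairs"
    using quadext_imp_has_degree_2 quadext_subfield(1) quadext_psubset[of F E]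
    by (auto simp: subfields_of_def)
qed

lemma M_not_subset: "\<not> M (Suc n) \<subseteq> M (Suc (Suc n))"
proof
  have level: "M (Suc n) \<in> level (Suc n)" "M (Suc (Suc n)) \<in> level (Suc (Suc n))"
    by (simp_all add: level_def)
  assume "M (Suc n) \<subseteq> M (Suc (Suc n))"
  moreover have "M (Suc n) \<noteq> M (Suc (Suc n))"
    using has_degree_unique[OF subfield_Rats has_degree_level[OF level(1)]]
      has_degree_level[OF level(2)] by fastforce
  moreover have "quadratic_tower (M (Suc (Suc n)))"
    using index_two_closed_levels level unfolding index_two_closed_def by blast
  ultimately obtain E where "M (Suc n) \<subseteq> E" "quadext E (M (Suc (Suc n)))"
    using quadratic_tower_index_two[OF _ subfield_tower_field] by blast
  hence "r * y (Suc n) \<in> L (Suc n)" using quadext_M_iff mem_tower_field[of "\<lambda>n. r * y n" "Suc n"]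
    by blast
  thus False using r_mult_y_notin_L by blast
qed

end

lemma UN_nat_eq:
  fixes A :: "nat \<Rightarrow> 'a set"
  shows "(\<Union>n. A n) = A 0 \<union> (\<Union>n\<in>{1..}. A n)"
proof -
  have UNIV_eq: "(UNIV :: nat set) = insert 0 {1..}" by (auto simp: Suc_le_eq)
  show ?thesis unfolding UNIV_eq UN_insert ..
qed

context
  fixes s t :: "nat \<Rightarrow> bool"
begin

interpretation two_towers "xseq 2 0 s" "xseq 2 1 t"
  by (intro two_towers.intro sqrt_tower_2_0_rigid sqrt_tower_xseq)

lemma Kn_Kinf_Mn_eq:
  "Kn 2 0 s = L" "Kn 2 1 t = K" "Mn s = M" "Kinf 2 0 s = L_inf" "Kinf 2 1 t = K_inf"
  unfolding Kn_eq_tower_field Kinf_eq_Union_tower_field L_inf_def K_inf_def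
  by (simp_all add: fun_eq_iff Mn_def tower_field_def)

lemma fields_eq_level: "{Kn 2 0 s n, Kn 2 1 t n, Mn s n} = level n"
  unfolding Kn_Kinf_Mn_eq level_def ..

lemma infinite_degree_proper_subfields_Kinf_2_1:
  "{F \<in> proper_subfields_of (Kinf 2 1 t). infinite_degree F \<rat>} = {Kinf 2 0 s}"
  unfolding Kn_Kinf_Mn_eq by (rule infinite_degree_proper_subfields)

lemma Kinf_2_1_eq_adjoin: "Kinf 2 1 t = adjoin (Kinf 2 0 s) {sqrtC 3}"
  unfolding Kn_Kinf_Mn_eq by (rule K_inf_eq_adjoin)

lemma Kn_2_1_Suc_eq_adjoin: "Kn 2 1 t (n + 1) = adjoin (Kn 2 0 s n) {sqrtC 3}"
  unfolding Kn_Kinf_Mn_eq by (simp add: K_Suc_eq)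

lemma Kn_2_0_neq_Kn_2_1_Suc: "Kn 2 0 s n \<noteq> Kn 2 1 t (n + 1)"
  unfolding Kn_Kinf_Mn_eq using quadext_psubset[OF quadext_L_K] by auto

lemma subfields_of_Kinf_2_1:
  "subfields_of (Kinf 2 1 t) =
    {\<rat>, Kinf 2 0 s, Kinf 2 1 t} \<union> (\<Union>n\<in>{1..}. {Kn 2 0 s n, Kn 2 1 t n, Mn s n})"
  unfolding fields_eq_level unfolding Kn_Kinf_Mn_eq subfields_of_K_inf UN_nat_eq[of level] level_0
  by auto

lemma distinct_fields_of_degree:
  assumes "n \<ge> 1"
  shows "distinct [Kn 2 0 s n, Kn 2 1 t n, Mn s n]"
  unfolding Kn_Kinf_Mn_eq using distinct_level[of "n - 1"] assms by simp

lemma subfields_of_Kinf_2_1_of_degree: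
  "{F \<in> subfields_of (Kinf 2 1 t). has_degree F \<rat> (2 ^ n)} = {Kn 2 0 s n, Kn 2 1 t n, Mn s n}"
  unfolding fields_eq_level unfolding Kn_Kinf_Mn_eq by (rule subfields_of_degree)

lemma degree_two_pairs_Kinf_2_1:
  "{(F, E). F \<in> subfields_of (Kinf 2 1 t) \<and> E \<in> subfields_of (Kinf 2 1 t) \<and> has_degree E F 2} =
    {(\<rat>, Kn 2 0 s 1), (\<rat>, Kn 2 1 t 1), (\<rat>, Mn s 1), (Kinf 2 0 s, Kinf 2 1 t)} \<union>
    (\<Union>n\<in>{1..}. {(Kn 2 0 s n, Kn 2 0 s (n + 1)), (Kn 2 0 s n, Mn s (n + 1)),
                  (Kn 2 0 s n, Kn 2 1 t (n + 1)), (Mn s n, Kn 2 1 t (n + 1)),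
                  (Kn 2 1 t n, Kn 2 1 t (n + 1))})"
proof -
  let ?step = "\<lambda>n. {(L n, L (Suc n)), (L n, M (Suc n))} \<union> level n \<times> {K (Suc n)}"
  have step_0: "?step 0 = {(\<rat>, L 1), (\<rat>, K 1), (\<rat>, M 1)}" using L.K_0 by (auto simp: level_0)
  have "?step n = {(L n, L (n + 1)), (L n, M (n + 1)), (L n, K (n + 1)), (M n, K (n + 1)),
      (K n, K (n + 1))}" for n
    by (auto simp: level_def)
  thus ?thesis
    unfolding Kn_Kinf_Mn_eq degree_two_pairs UN_nat_eq[of ?step] step_0 by auto
qed

lemma Mn_not_subset:
  assumes "n \<ge> 1"
  shows "\<not> Mn s n \<subseteq> Mn s (n + 1)"
  unfolding Kn_Kinf_Mn_eq using M_not_subset[of "n - 1"] assms by simp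

end

theorem theorem1p4:
  shows
    \<comment> \<open>(1)\<close>
    "(\<forall>\<nu> x0 s. (\<nu>, x0) \<in> Omega \<longrightarrow> (\<nexists>a::int. u \<nu> 0 - x0 = a\<^sup>2) \<longrightarrow>
        proper_subfields_of (Kinf \<nu> x0 s) = range (Kn \<nu> x0 s))
    \<and>
     (\<forall>\<nu> x0 s (a::int). (\<nu>, x0) \<in> Omega \<longrightarrow> u \<nu> 0 - x0 = a\<^sup>2 \<longrightarrow> \<nu> \<ge> 3 \<longrightarrow>
        proper_subfields_of (Kinf \<nu> x0 s) =
          range (Kn \<nu> x0 s) \<union> {adjoin \<rat> {sqrtC (2 * (\<nu> - a))}, adjoin \<rat> {sqrtC (2 * (\<nu> + a))}} \<and>
        has_degree (adjoin \<rat> {sqrtC (2 * (\<nu> - a))}) \<rat> 2 \<and>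
        has_degree (adjoin \<rat> {sqrtC (2 * (\<nu> + a))}) \<rat> 2 \<and>
        adjoin \<rat> {sqrtC (2 * (\<nu> - a))} \<noteq> adjoin \<rat> {sqrtC (2 * (\<nu> + a))} \<and>
        adjoin \<rat> {sqrtC (2 * (\<nu> - a))} \<notin> range (Kn \<nu> x0 s) \<and>
        adjoin \<rat> {sqrtC (2 * (\<nu> + a))} \<notin> range (Kn \<nu> x0 s) \<and>
        adjoin \<rat> {sqrtC (2 * (\<nu> - a))} \<subseteq> Kn \<nu> x0 s 2 \<and>
        adjoin \<rat> {sqrtC (2 * (\<nu> + a))} \<subseteq> Kn \<nu> x0 s 2)
    \<and>
     infinite {(\<nu>, x0). (\<nu>, x0) \<in> Omega \<and> \<nu> \<ge> 3 \<and> (\<exists>a::int. u \<nu> 0 - x0 = a\<^sup>2)}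
    \<and>
     (\<forall>s t.
        {F \<in> proper_subfields_of (Kinf 2 1 t). infinite_degree F \<rat>} = {Kinf 2 0 s} \<and>
        Kinf 2 1 t = adjoin (Kinf 2 0 s) {sqrtC 3} \<and>
        (\<forall>n\<ge>1. Kn 2 1 t (n + 1) = adjoin (Kn 2 0 s n) {sqrtC 3} \<and>
                Kn 2 0 s n \<noteq> Kn 2 1 t (n + 1)) \<and>
        subfields_of (Kinf 2 1 t) =
          {\<rat>, Kinf 2 0 s, Kinf 2 1 t} \<union> (\<Union>n\<in>{1..}. {Kn 2 0 s n, Kn 2 1 t n, Mn s n}) \<and>
        (\<forall>n\<ge>1. distinct [Kn 2 0 s n, Kn 2 1 t n, Mn s n] \<and>
                {F \<in> subfields_of (Kinf 2 1 t). has_degree F \<rat> (2 ^ n)} =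
                  {Kn 2 0 s n, Kn 2 1 t n, Mn s n}) \<and>
        {(F, E). F \<in> subfields_of (Kinf 2 1 t) \<and> E \<in> subfields_of (Kinf 2 1 t) \<and> has_degree E F 2} =
          {(\<rat>, Kn 2 0 s 1), (\<rat>, Kn 2 1 t 1), (\<rat>, Mn s 1), (Kinf 2 0 s, Kinf 2 1 t)} \<union>
          (\<Union>n\<in>{1..}. {(Kn 2 0 s n, Kn 2 0 s (n + 1)), (Kn 2 0 s n, Mn s (n + 1)),
                        (Kn 2 0 s n, Kn 2 1 t (n + 1)), (Mn s n, Kn 2 1 t (n + 1)),
                        (Kn 2 1 t n, Kn 2 1 t (n + 1))}) \<and>
        (\<forall>n\<ge>1. \<not> Mn s n \<subseteq> Mn s (n + 1)))"
    (is "?nonsquare \<and> ?square \<and> ?infinite \<and> ?towers_2_0_2_1")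
proof (intro conjI)
  show ?nonsquare
    by (intro allI impI Omega_nonsquare_proper_subfields)
  show ?square
    by (intro allI impI conjI Omega_square_proper_subfields Omega_square_quadratic_subfields)
  show ?infinite
    by (rule infinite_Omega_square)
  show ?towers_2_0_2_1
    by (intro allI impI conjI infinite_degree_proper_subfields_Kinf_2_1 Kinf_2_1_eq_adjoin
        Kn_2_1_Suc_eq_adjoin Kn_2_0_neq_Kn_2_1_Suc subfields_of_Kinf_2_1 distinct_fields_of_degree
        subfields_of_Kinf_2_1_of_degree degree_two_pairs_Kinf_2_1 Mn_not_subset)
qed

end
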